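(* Consider the stochastic $K$-armed bandit problem with adversarial corruptions described in the context, and let the agent run the algorithm BARBAT described in the context. Then the pseudo-regret satisfies \[ R(T) = O\bigg(C + \sum_{k:\Delta_k > 0}\frac{\log(T)\log(KT)}{\Delta_k} + \frac{K\log(1 / \Delta)\log(K / \Delta)}{\Delta}\bigg), \] where the $O(\cdot)$ hides only absolute constants.
   Context: Setting. There are $K\ge 2$ arms $[K]=\{1,\dots,K\}$ and a horizon of $T$ rounds. In each round $t$, the environment draws a reward vector $(r_{t,k})_{k\in[K]}$ i.i.d. across rounds from a fixed unknown distribution with values in $[0,1]$; let $\mu_k=\mathbb{E}[r_{t,k}]$. An adversary, who sees this reward vector, replaces it by a corrupted vector $(\widetilde r_{t,k})_{k\in[K]}$ with values in $[0,1]$. The agent then selects an arm $I_t$ and observes only $\widetilde r_{t,I_t}$. The corruption level is $C=\sum_{t=1}^T\max_{k\in[K]}|\widetilde r_{t,k}-r_{t,k}|$. Let $k^*\in\arg\max_k\mu_k$, $\Delta_k=\mu_{k^*}-\mu_k$, and $\Delta=\min_{k:\Delta_k>0}\Delta_k$ (assumed to exist). The pseudo-regret is $R(T)=\mathbb{E}\big[\sum_{t=1}^T\Delta_{I_t}\big]$. Algorithm BARBAT. Initialize $T_0=0$, $\Delta_k^0=1$, $r_k^0=0$ for all $k$. For epochs $m=1,2,\dots$ (stopping when round $T$ is reached): set $\zeta_m=(m+4)2^{2(m+4)}\ln K$, $\delta_m=1/(K\zeta_m)$, $\lambda_m=2^8\ln(4K/\delta_m)$, $\beta_m=\delta_m/K$,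 $n_k^m=\lambda_m(\Delta_k^{m-1})^{-2}$ for all $k$, $N_m=\lceil K\lambda_m2^{2(m-1)}\rceil$, $T_m=T_{m-1}+N_m$; let $k_m=\arg\max_k r_k^{m-1}$ (ties broken by smallest index), and set $\widetilde n_k^m=n_k^m$ for $k\ne k_m$ and $\widetilde n_{k_m}^m=N_m-\sum_{k\ne k_m}n_k^m$. For each round $t=T_{m-1}+1,\dots,T_m$, draw $I_t$ independently with $\Pr[I_t=k]=p_m(k)=\widetilde n_k^m/N_m$, observe $\widetilde r_{t,I_t}$ and add it to $S_{I_t}^m$ (where $S_k^m$ starts at $0$ in each epoch). At the end of the epoch, set $r_k^m=\min\{S_k^m/\widetilde n_k^m,1\}$, $r_*^m=\max_{k}\big\{r_k^m-\sqrt{4\ln(4/\beta_m)/\widetilde n_k^m}\big\}$, and $\Delta_k^m=\max\{2^{-m},r_*^m-r_k^m\}$. *)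

theory Defs
  imports "HOL-Probability.Probability"
begin

text \<open>Arms are the natural numbers 0,...,K-1 (paper's arms 1..K shifted by one; the
order, hence the tie-breaking rule "smallest index", is preserved).  Rounds are
0-indexed: round t here is the paper's round t+1.  Reward vectors are functions
nat => real (only coordinates below K matter).\<close>

definition zeta :: "nat \<Rightarrow> nat \<Rightarrow> real" where
  "zeta K m = real (m + 4) * 2 ^ (2 * (m + 4)) * ln (real K)"

definition delta_par :: "nat \<Rightarrow> nat \<Rightarrow> real" where
  "delta_par K m = 1 / (real K * zeta K m)"

definition lambda_par :: "nat \<Rightarrow> nat \<Rightarrow> real" where
  "lambda_par K m = 2 ^ 8 * ln (4 * real K / delta_par K m)"

definition beta_par :: "nat \<Rightarrow> nat \<Rightarrow> real" where
  "beta_par K m = delta_par K m / real K"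

definition N_ep :: "nat \<Rightarrow> nat \<Rightarrow> nat" where
  "N_ep K m = nat \<lceil>real K * lambda_par K m * 2 ^ (2 * (m - 1))\<rceil>"

definition T_ep :: "nat \<Rightarrow> nat \<Rightarrow> nat" where
  "T_ep K m = (\<Sum>j\<in>{1..m}. N_ep K j)"

definition epoch_of :: "nat \<Rightarrow> nat \<Rightarrow> nat" where
  "epoch_of K t = (LEAST m. t < T_ep K m)"

definition leader :: "nat \<Rightarrow> (nat \<Rightarrow> real) \<Rightarrow> nat" where
  "leader K r = (LEAST k. k < K \<and> (\<forall>j<K. r j \<le> r k))"

definition n_base :: "nat \<Rightarrow> nat \<Rightarrow> (nat \<Rightarrow> real) \<Rightarrow> nat \<Rightarrow> real" where
  "n_base K m Dl k = lambda_par K m / (Dl k) ^ 2"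

definition n_tilde :: "nat \<Rightarrow> nat \<Rightarrow> (nat \<Rightarrow> real) \<Rightarrow> (nat \<Rightarrow> real) \<Rightarrow> nat \<Rightarrow> real" where
  "n_tilde K m Dl r k =
     (if k = leader K r
      then real (N_ep K m) - (\<Sum>j\<in>{..<K} - {leader K r}. n_base K m Dl j)
      else n_base K m Dl k)"

definition probs :: "nat \<Rightarrow> nat \<Rightarrow> (nat \<Rightarrow> real) \<Rightarrow> (nat \<Rightarrow> real) \<Rightarrow> nat \<Rightarrow> real" where
  "probs K m Dl r k = n_tilde K m Dl r k / real (N_ep K m)"

text \<open>A history h is the list of pairs (I_s, observed corrupted reward of I_s), s = 0,1,...\<close>
definition epoch_sum :: "nat \<Rightarrow> nat \<Rightarrow> (nat \<times> real) list \<Rightarrow> nat \<Rightarrow> real" where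
  "epoch_sum K m h k =
     (\<Sum>s\<in>{T_ep K (m - 1)..<T_ep K m}. if fst (h ! s) = k then snd (h ! s) else 0)"

fun barbat_state :: "nat \<Rightarrow> (nat \<times> real) list \<Rightarrow> nat \<Rightarrow> (nat \<Rightarrow> real) \<times> (nat \<Rightarrow> real)" where
  "barbat_state K h 0 = ((\<lambda>k. 1), (\<lambda>k. 0))"
| "barbat_state K h (Suc m) =
     (let Dl = fst (barbat_state K h m);
          r = snd (barbat_state K h m);
          nt = n_tilde K (Suc m) Dl r;
          r' = (\<lambda>k. min (epoch_sum K (Suc m) h k / nt k) 1);
          rstar = Max ((\<lambda>k. r' k - sqrt (4 * ln (4 / beta_par K (Suc m)) / nt k)) ` {..<K});
          D' = (\<lambda>k. max ((1 / 2) ^ Suc m) (rstar - r' k))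
      in (D', r'))"

definition barbat_probs :: "nat \<Rightarrow> (nat \<times> real) list \<Rightarrow> nat \<Rightarrow> nat \<Rightarrow> real" where
  "barbat_probs K h t =
     (let m = epoch_of K t in
      probs K m (fst (barbat_state K h (m - 1))) (snd (barbat_state K h (m - 1))))"

text \<open>Drawing an arm with distribution p from a uniform u in [0,1] (inverse CDF):
  if u is uniform on [0,1] the result equals k with probability p k.\<close>
definition choose_arm :: "nat \<Rightarrow> (nat \<Rightarrow> real) \<Rightarrow> real \<Rightarrow> nat" where
  "choose_arm K p u =
     (if \<exists>k<K. u < (\<Sum>j\<le>k. p j) then (LEAST k. u < (\<Sum>j\<le>k. p j)) else K - 1)"

text \<open>An adaptive adversary: at round t it sees the uncorrupted reward vectors r_s for
s \<le> t and the arms I_s for s < t, and outputs the corrupted reward vector.\<close>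
type_synonym adversary = "nat \<Rightarrow> (nat \<Rightarrow> nat \<Rightarrow> real) \<Rightarrow> (nat \<Rightarrow> nat) \<Rightarrow> nat \<Rightarrow> real"

text \<open>Outcome omega t = (reward vector of round t, uniform random number of the agent at round t).\<close>
fun arms_prefix :: "nat \<Rightarrow> adversary \<Rightarrow> (nat \<Rightarrow> (nat \<Rightarrow> real) \<times> real) \<Rightarrow> nat \<Rightarrow> nat list" where
  "arms_prefix K adv \<omega> 0 = []"
| "arms_prefix K adv \<omega> (Suc t) =
     (let l = arms_prefix K adv \<omega> t;
          I = (\<lambda>s. if s < length l then l ! s else 0);
          h = map (\<lambda>s. (l ! s, adv s (\<lambda>s'. fst (\<omega> s')) I (l ! s))) [0..<t]
      in l @ [choose_arm K (barbat_probs K h t) (snd (\<omega> t))])"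

definition arm :: "nat \<Rightarrow> adversary \<Rightarrow> (nat \<Rightarrow> (nat \<Rightarrow> real) \<times> real) \<Rightarrow> nat \<Rightarrow> nat" where
  "arm K adv \<omega> t = arms_prefix K adv \<omega> (Suc t) ! t"

definition corrupted :: "nat \<Rightarrow> adversary \<Rightarrow> (nat \<Rightarrow> (nat \<Rightarrow> real) \<times> real) \<Rightarrow> nat \<Rightarrow> nat \<Rightarrow> real" where
  "corrupted K adv \<omega> t = adv t (\<lambda>s. fst (\<omega> s)) (arm K adv \<omega>)"

definition corruption :: "nat \<Rightarrow> adversary \<Rightarrow> (nat \<Rightarrow> (nat \<Rightarrow> real) \<times> real) \<Rightarrow> nat \<Rightarrow> real" where
  "corruption K adv \<omega> T =
     (\<Sum>t<T. Max ((\<lambda>k. \<bar>corrupted K adv \<omega> t k - fst (\<omega> t) k\<bar>) ` {..<K}))"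

definition vec_space :: "(nat \<Rightarrow> real) measure" where
  "vec_space = PiM UNIV (\<lambda>_. borel)"

definition omega_space :: "(nat \<Rightarrow> real) measure \<Rightarrow> (nat \<Rightarrow> (nat \<Rightarrow> real) \<times> real) measure" where
  "omega_space D = PiM UNIV (\<lambda>_::nat. D \<Otimes>\<^sub>M uniform_measure lborel {0..1::real})"

definition valid_reward_dist :: "nat \<Rightarrow> (nat \<Rightarrow> real) measure \<Rightarrow> bool" where
  "valid_reward_dist K D \<longleftrightarrow>
     prob_space D \<and> sets D = sets vec_space \<and> (AE x in D. \<forall>k<K. 0 \<le> x k \<and> x k \<le> 1)"

definition valid_adversary :: "nat \<Rightarrow> adversary \<Rightarrow> bool" where
  "valid_adversary K adv \<longleftrightarrow>
     (\<forall>t r I. \<forall>k<K. 0 \<le> adv t r I k \<and> adv t r I k \<le> 1) \<and>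
     (\<forall>t r r' I I'. (\<forall>s\<le>t. r s = r' s) \<longrightarrow> (\<forall>s<t. I s = I' s) \<longrightarrow> adv t r I = adv t r' I') \<and>
     (\<forall>t. (\<lambda>(r, I). adv t r I) \<in>
           (PiM UNIV (\<lambda>_::nat. vec_space) \<Otimes>\<^sub>M PiM UNIV (\<lambda>_::nat. count_space (UNIV :: nat set)))
           \<rightarrow>\<^sub>M vec_space)"

definition mean :: "(nat \<Rightarrow> real) measure \<Rightarrow> nat \<Rightarrow> real" where
  "mean D k = (\<integral>x. x k \<partial>D)"

definition gap :: "nat \<Rightarrow> (nat \<Rightarrow> real) measure \<Rightarrow> nat \<Rightarrow> real" where
  "gap K D k = Max (mean D ` {..<K}) - mean D k"

definition min_gap :: "nat \<Rightarrow> (nat \<Rightarrow> real) measure \<Rightarrow> real" where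
  "min_gap K D = Min {gap K D k | k. k < K \<and> 0 < gap K D k}"

definition pseudo_regret :: "nat \<Rightarrow> (nat \<Rightarrow> real) measure \<Rightarrow> adversary \<Rightarrow> nat \<Rightarrow> real" where
  "pseudo_regret K D adv T = (\<integral>\<omega>. (\<Sum>t<T. gap K D (arm K adv \<omega> t)) \<partial>omega_space D)"

end

theory Submission
  imports Defs
begin

text \<open>
  Let \<open>C_m\<close> be the corruption inside epoch \<open>m\<close>. In epoch \<open>m\<close> every estimate \<open>r_k^m\<close> is
  within its confidence width plus \<open>C_m / N_m\<close> of \<open>\<mu>_k\<close>, except on a bad event of probability
  at most \<open>\<delta>_m\<close>. A bad epoch is treated as a corrupted one: the additive error \<open>e_m\<close> is
  \<open>C_m / N_m\<close> on the good event and \<open>1\<close> otherwise, so that the remaining analysis is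
  deterministic. Since the widths are at most \<open>\<Delta>_k^{m-1} / 8\<close>, the estimates \<open>\<Delta>_k^m\<close> agree with
  the true gaps up to constant factors, \<open>2^{-m}\<close> and the discounted error
  \<open>\<rho>_m = e_m + e_{m-1} / 8 + e_{m-2} / 64 + \<dots>\<close>. Each non-leading arm is drawn at most about
  \<open>N_m / K\<close> times per epoch, so an error \<open>\<rho>\<close> costs only \<open>O(\<rho> N)\<close> over all arms together, and
  \<open>N_{m+1} \<le> 6 N_m\<close> makes the weighted sum of the \<open>\<rho>_m\<close> at most \<open>O(\<Sum> N_m e_m)\<close>. A leader
  with positive gap is suboptimal by \<open>O(2^{-m})\<close> up to \<open>\<rho>\<close>, which is possible only in epochs
  with \<open>2^m = O(1 / \<Delta>)\<close>. In expectation \<open>N_m e_m\<close> is at most \<open>E[C_m] + \<delta>_m N_m\<close>, and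
  \<open>\<delta>_m N_m = O(1)\<close>.

  The bad event is bounded by an exponential supermartingale. Conditionally on the past and on
  the reward vector the arm is an independent draw, so replacing the corrupted by the true reward
  costs at most \<open>p |\<theta>|\<close> times the corruption of the round in the exponent.
\<close>

subsection \<open>Size of the algorithm parameters\<close>

text \<open>The logarithm under the confidence widths. As \<open>lambda_par\<close> is 256 times
  \<open>conf\<close>, a sample of size \<open>lambda_par / Dl^2\<close> has width exactly
  \<open>Dl / 8\<close>.\<close>

definition conf :: "nat \<Rightarrow> nat \<Rightarrow> real" where
  "conf K m = ln (4 / beta_par K m)"

lemma ln2_ge: "1 / 2 \<le> ln (2::real)"
proof -
  have "exp (1/2 :: real) \<le> 1 + 1/2 + (1/2)\<^sup>2" by (rule exp_bound) auto
  also have "\<dots> \<le> 2" by (simp add: power2_eq_square)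
  finally have "exp (1/2) \<le> (2::real)" .
  thus ?thesis using ln_ge_iff[of 2 "1 / 2"] by simp
qed

lemma ln2_le: "ln (2::real) \<le> 1"
  using ln_le_minus_one[of "2::real"] by simp

lemma ln4_eq: "ln (4::real) = 2 * ln 2"
  using ln_realpow[of "2::real" 2] by simp

lemma ln_arms_ge: "2 \<le> K \<Longrightarrow> 1 / 2 \<le> ln (real K)"
  using ln2_ge ln_mono[of 2 "real K"] by linarith

lemma zeta_pos: "2 \<le> K \<Longrightarrow> 0 < zeta K m"
  using ln_arms_ge[of K] by (simp add: zeta_def)

lemma inverse_beta: "2 \<le> K \<Longrightarrow> 4 / beta_par K m = 4 * real K ^ 2 * zeta K m"
  by (simp add: beta_par_def delta_par_def power2_eq_square)

lemma lambda_eq_conf: "2 \<le> K \<Longrightarrow> lambda_par K m = 256 * conf K m"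
  by (simp add: lambda_par_def conf_def beta_par_def)

lemma conf_eq:
  assumes "2 \<le> K"
  shows "conf K m = ln 4 + 2 * ln (real K) + ln (real (m + 4)) + 2 * real (m + 4) * ln 2 + ln (ln (real K))"
proof -
  have *: "ln (4 * a * (b * c * d)) = ln 4 + ln a + ln b + ln c + ln d"
    if "0 < a" "0 < b" "0 < c" "0 < d" for a b c d :: real
    using that by (simp add: ln_mult)
  have "ln (2 ^ (2 * (m + 4)) :: real) = 2 * real (m + 4) * ln 2"
    using ln_realpow[of "2::real" "2 * (m + 4)"] by (simp only: of_nat_mult of_nat_numeral)
  moreover have "ln (real K ^ 2) = 2 * ln (real K)"
    using assms ln_realpow[of "real K" 2] by simp
  moreover have "ln (4 * real K ^ 2 * (real (m + 4) * 2 ^ (2 * (m + 4)) * ln (real K)))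
      = ln 4 + ln (real K ^ 2) + ln (real (m + 4)) + ln (2 ^ (2 * (m + 4))) + ln (ln (real K))"
    by (rule *) (use assms ln_arms_ge[OF assms] in auto)
  ultimately show ?thesis
    unfolding conf_def inverse_beta[OF assms] zeta_def by linarith
qed

text \<open>One epoch adds at most \<open>ln 5\<close> to \<open>conf\<close>; this bound turns that
  additive growth into the factor 6/5 of \<open>conf_Suc_le\<close>.\<close>

lemma conf_ge:
  assumes "2 \<le> K" shows "5 * ln 5 \<le> conf K m"
proof -
  have "5 * ln (5::real) = ln (5 ^ 5)" using ln_realpow[of "5::real" 5] by simp
  also have "\<dots> \<le> ln (4 * real K ^ 2 * zeta K m)"
  proof (rule ln_mono)
    have "(2::real) ^ 2 \<le> real K ^ 2" using assms by (intro power_mono) auto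
    hence k: "4 * 4 \<le> 4 * real K ^ 2" by simp
    have "(2::real) ^ 8 \<le> 2 ^ (2 * (m + 4))" by (intro power_increasing) auto
    hence "4 * 2 ^ 8 \<le> real (m + 4) * 2 ^ (2 * (m + 4))" by (intro mult_mono) auto
    from mult_mono[OF this ln_arms_ge[OF assms]] have "4 * 2 ^ 8 * (1 / 2) \<le> zeta K m"
      unfolding zeta_def by simp
    with k have "4 * 4 * (4 * 2 ^ 8 * (1 / 2)) \<le> 4 * real K ^ 2 * zeta K m"
      by (intro mult_mono) auto
    moreover have "(5::real) ^ 5 \<le> 4 * 4 * (4 * 2 ^ 8 * (1 / 2))" by simp
    ultimately show "5 ^ 5 \<le> 4 * real K ^ 2 * zeta K m" by (rule order_trans[rotated])
  qed simp
  finally show ?thesis using assms by (simp add: conf_def inverse_beta)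
qed

lemma conf_ge_1: "2 \<le> K \<Longrightarrow> 1 \<le> conf K m"
  using conf_ge[of K m] ln2_ge ln_mono[of 2 "5::real"] by linarith

lemma lambda_ge: "2 \<le> K \<Longrightarrow> 256 \<le> lambda_par K m"
  using conf_ge_1[of K m] by (simp add: lambda_eq_conf)

lemma conf_Suc_le:
  assumes "2 \<le> K" shows "conf K (Suc m) \<le> 6 / 5 * conf K m"
proof -
  have "conf K (Suc m) - conf K m = ln (real (m + 5)) - ln (real (m + 4)) + 2 * ln 2"
    using assms by (simp add: conf_eq algebra_simps)
  also have "\<dots> = ln (real (m + 5) / real (m + 4)) + ln 4"
    by (simp add: ln_div ln4_eq)
  \<comment> \<open>The ratio \<open>(m + 5) / (m + 4)\<close> is largest at
    \<open>m = 0\<close>.\<close>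
  also have "\<dots> \<le> ln (5 / 4) + ln 4"
    by (intro add_mono ln_mono) (auto simp: field_simps)
  also have "\<dots> = ln 5" by (simp add: ln_div)
  finally show ?thesis using conf_ge[OF assms, of m] by linarith
qed

lemma conf_mono:
  assumes "2 \<le> K" "m \<le> n" shows "conf K m \<le> conf K n"
proof -
  have "ln (real (m + 4)) \<le> ln (real (n + 4))" using assms(2) by simp
  moreover have "2 * real (m + 4) * ln 2 \<le> 2 * real (n + 4) * ln 2"
    using assms(2) by simp
  moreover note conf_eq[OF assms(1), of m] conf_eq[OF assms(1), of n]
  ultimately show ?thesis by linarith
qed

lemma lambda_mono: "2 \<le> K \<Longrightarrow> m \<le> n \<Longrightarrow> lambda_par K m \<le> lambda_par K n"
  by (simp add: lambda_eq_conf conf_mono)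

lemma lambda_le:
  assumes "2 \<le> K" "1 \<le> m"
  shows "lambda_par K m \<le> 4096 * (ln (real K) + real m)"
proof -
  have k: "1 / 2 \<le> ln (real K)" using ln_arms_ge assms by blast
  have "ln (ln (real K)) \<le> ln (real K) - 1" "ln (real (m + 4)) \<le> real (m + 4) - 1"
    using k by (intro ln_le_minus_one; simp)+
  moreover note ln4_eq
  moreover have "2 * real (m + 4) * ln 2 \<le> 2 * real (m + 4) * 1"
    using ln2_le by (intro mult_left_mono) auto
  ultimately have "conf K m \<le> 3 * ln (real K) + 3 * real m + 12"
    unfolding conf_eq[OF assms(1)] using ln2_le by (simp add: algebra_simps)
  also have "\<dots> \<le> 16 * (ln (real K) + real m)"
    using k assms(2) by simp
  finally show ?thesis using assms by (simp add: lambda_eq_conf)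
qed

lemma N_ep_ge: "real K * lambda_par K (Suc n) * 4 ^ n \<le> real (N_ep K (Suc n))"
  using real_nat_ceiling_ge[of "real K * lambda_par K (Suc n) * 4 ^ n"]
  by (simp add: N_ep_def power_mult)

text \<open>Makes the unit added by the ceiling in \<open>N_ep\<close> negligible.\<close>

lemma N_ep_base:
  assumes "2 \<le> K" shows "512 * 4 ^ n \<le> real K * lambda_par K (Suc n) * 4 ^ n"
proof -
  have "2 * 256 \<le> real K * lambda_par K (Suc n)"
    using assms lambda_ge[OF assms] by (intro mult_mono) auto
  thus ?thesis by simp
qed

lemma N_ep_le_add1:
  assumes "2 \<le> K"
  shows "real (N_ep K (Suc n)) \<le> real K * lambda_par K (Suc n) * 4 ^ n + 1"
proof -
  have "0 \<le> real K * lambda_par K (Suc n) * 4 ^ n"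
    using lambda_ge[OF assms, of "Suc n"] by simp
  thus ?thesis unfolding N_ep_def by (simp add: power_mult)
qed

lemma N_ep_le:
  assumes "2 \<le> K"
  shows "real (N_ep K (Suc n)) \<le> 2 * (real K * lambda_par K (Suc n) * 4 ^ n)"
  using N_ep_le_add1[OF assms, of n] N_ep_base[OF assms, of n] one_le_power[of "4::real" n]
  by linarith

lemma N_ep_pos: "2 \<le> K \<Longrightarrow> 0 < N_ep K (Suc n)"
  using N_ep_ge[of K n] N_ep_base[of K n] one_le_power[of "4::real" n] by linarith

text \<open>Without the ceiling the growth factor is \<open>4 * 6/5 = 24/5\<close>. What matters is
  that 6 stays below 8, the rate at which \<open>\<rho>\<close> discounts old errors.\<close>

lemma N_ep_Suc_le:
  assumes "2 \<le> K" shows "real (N_ep K (Suc (Suc n))) \<le> 6 * real (N_ep K (Suc n))"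
proof -
  have "lambda_par K (Suc (Suc n)) \<le> 6 / 5 * lambda_par K (Suc n)"
    using conf_Suc_le[OF assms, of "Suc n"] assms by (simp add: lambda_eq_conf)
  hence "real K * lambda_par K (Suc (Suc n)) * 4 ^ Suc n
      \<le> real K * (6 / 5 * lambda_par K (Suc n)) * 4 ^ Suc n"
    by (intro mult_right_mono mult_left_mono) auto
  also have "\<dots> = 24 / 5 * (real K * lambda_par K (Suc n) * 4 ^ n)" by simp
  finally show ?thesis
    using N_ep_le_add1[OF assms, of "Suc n"] N_ep_ge[of K n] N_ep_base[OF assms, of n]
      one_le_power[of "4::real" n] by linarith
qed

text \<open>The power of 4 in \<open>zeta\<close> cancels that in \<open>N_ep\<close>, leaving at
  most \<open>lambda_par / (512 (n + 5) ln K)\<close>, which is bounded because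
  \<open>lambda_par\<close> is \<open>O(ln K + n)\<close>. Hence a possible failure costs only O(1)
  expected rounds per epoch.\<close>

lemma delta_N_ep_le:
  assumes "2 \<le> K" shows "delta_par K (Suc n) * real (N_ep K (Suc n)) \<le> 18"
proof -
  define l where "l = ln (real K)"
  have l: "1 / 2 \<le> l" using ln_arms_ge[OF assms] by (simp add: l_def)
  have "delta_par K (Suc n) * real (N_ep K (Suc n))
      \<le> delta_par K (Suc n) * (2 * (real K * lambda_par K (Suc n) * 4 ^ n))"
    using zeta_pos[OF assms, of "Suc n"] assms
    by (intro mult_left_mono N_ep_le) (auto simp: delta_par_def)
  also have "\<dots> = lambda_par K (Suc n) / (512 * (real n + 5) * l)"
  proof -
    have e: "(2::real) ^ (2 * (Suc n + 4)) = 4 ^ n * 1024"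
      by (simp add: power_add power_mult)
    have d: "delta_par K (Suc n) = 1 / (real K * ((real n + 5) * (4 ^ n * 1024) * l))"
      unfolding delta_par_def zeta_def l_def e by simp
    have *: "1 / (k * (a * (p * 1024) * b)) * (2 * (k * x * p)) = x / (512 * a * b)"
      if "k \<noteq> 0" "p \<noteq> 0" for k a p b x :: real
      using that by (cases "a * b = 0") (auto simp: divide_simps)
    show ?thesis unfolding d by (rule *) (use assms in auto)
  qed
  also have "\<dots> \<le> 4096 * (l + real (Suc n)) / (512 * (real n + 5) * l)"
    using l lambda_le[OF assms, of "Suc n"] by (intro divide_right_mono) (auto simp: l_def)
  also have "\<dots> \<le> 18"
  proof -
    have "4096 * (l + real (Suc n)) \<le> 18 * (512 * (real n + 5) * l)"
    proof -
      have *: "4096 * a \<le> 9216 * b + 46080 * l" if "a \<le> l + 2 * b + 2 * l" "0 \<le> b" for a b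
        using that l by linarith
      have "1 * (real n + 1) \<le> (2 * l) * (real n + 1)" using l by (intro mult_right_mono) auto
      moreover have "0 \<le> l * real n" using l by simp
      ultimately have "l + real (Suc n) \<le> l + 2 * (l * real n) + 2 * l" by (simp add: algebra_simps)
      hence "4096 * (l + real (Suc n)) \<le> 9216 * (l * real n) + 46080 * l"
        using *[of "l + real (Suc n)" "l * real n"] \<open>0 \<le> l * real n\<close> by simp
      also have "\<dots> = 18 * (512 * (real n + 5) * l)" by (simp add: algebra_simps)
      finally show ?thesis .
    qed
    thus ?thesis using l by (simp add: pos_divide_le_eq)
  qed
  finally show ?thesis .
qed

section \<open>Epoch boundaries and the number of epochs\<close>

lemma T_ep_0 [simp]: "T_ep K 0 = 0"
  by (simp add: T_ep_def)

lemma T_ep_Suc: "T_ep K (Suc m) = T_ep K m + N_ep K (Suc m)"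
  by (simp add: T_ep_def)

lemma T_ep_mono: "m \<le> n \<Longrightarrow> T_ep K m \<le> T_ep K n"
  unfolding T_ep_def by (intro sum_mono2) auto

lemma T_ep_ge: "2 \<le> K \<Longrightarrow> m \<le> T_ep K m"
proof (induction m)
  case (Suc m)
  thus ?case using N_ep_pos[of K m] by (simp add: T_ep_Suc)
qed simp

lemma epoch_of_eq:
  assumes "T_ep K m \<le> t" "t < T_ep K (Suc m)" shows "epoch_of K t = Suc m"
  unfolding epoch_of_def
proof (rule Least_equality)
  show "t < T_ep K (Suc m)" by (rule assms)
  fix n assume "t < T_ep K n"
  thus "Suc m \<le> n" using assms(1) T_ep_mono[of n m K] by (meson not_less_eq_eq order.strict_trans2 leD)
qed

lemma ex_epoch:
  assumes "2 \<le> K" obtains m where "T_ep K m \<le> t" "t < T_ep K (Suc m)"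
proof -
  define n where "n = (LEAST n. t < T_ep K n)"
  have n: "t < T_ep K n" unfolding n_def
    by (rule LeastI[of _ "Suc t"]) (use T_ep_ge[OF assms, of "Suc t"] in auto)
  then obtain m where m: "n = Suc m" by (cases n) auto
  have "T_ep K m \<le> t" using not_less_Least[of m "\<lambda>n. t < T_ep K n"] m n_def by auto
  thus ?thesis using that n m by blast
qed

text \<open>The last complete epoch alone has at least \<open>4 ^ m\<close> rounds, so
  \<open>m\<close> is logarithmic in \<open>T\<close>; \<open>1 / 2 \<le> ln T\<close> absorbs the
  additional epoch still running.\<close>

lemma epoch_count_le:
  assumes "2 \<le> K" "2 \<le> T" "T_ep K m < T" shows "real (Suc m) \<le> 3 * ln (real T)"
proof -
  have "(4::real) ^ m \<le> real T"
  proof (cases m)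
    case (Suc j)
    have "512 * (4::real) ^ j \<le> real (N_ep K (Suc j))"
      using N_ep_base[OF assms(1), of j] N_ep_ge[of K j] by linarith
    also have "\<dots> \<le> real (T_ep K (Suc j))" by (simp add: T_ep_Suc)
    finally show ?thesis using assms(3) Suc by simp
  qed (use assms in simp)
  hence "real m * ln 4 \<le> ln (real T)"
    using ln_mono[of "4 ^ m" "real T"] by (simp add: ln_realpow)
  moreover note ln4_eq
  moreover have "real m * 1 \<le> real m * ln 4"
    using ln2_ge ln4_eq by (intro mult_left_mono) auto
  moreover have "1 / 2 \<le> ln (real T)" using ln_arms_ge assms(2) by blast
  ultimately show ?thesis by simp
qed

subsection \<open>Deterministic analysis of a run with given estimation errors\<close>

text \<open>The floor on \<open>Dl\<close> already makes all sample sizes positive. This part is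
  kept apart because the bounds on the estimates, required to instantiate \<open>barbat_run\<close>,
  rely on that positivity.\<close>

locale barbat_core =
  fixes K :: nat and Dl r :: "nat \<Rightarrow> nat \<Rightarrow> real"
  assumes K: "2 \<le> K"
    and Dl_ge: "\<And>m k. (1 / 2) ^ m \<le> Dl m k"
begin

lemma arms_nonempty: "{..<K} \<noteq> {}"
  using K by (auto simp: lessThan_empty_iff)

lemma conf_pos: "0 < conf K m"
  using conf_ge_1[OF K, of m] by linarith

lemma lambda_pos: "0 < lambda_par K m"
  using lambda_ge[OF K, of m] by linarith

lemma leader_less: "leader K (r m) < K"
  and leader_max: "j < K \<Longrightarrow> r m j \<le> r m (leader K (r m))"
proof -
  have "Max (r m ` {..<K}) \<in> r m ` {..<K}" using arms_nonempty by (intro Max_in) auto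
  then obtain k where k: "k < K" "Max (r m ` {..<K}) = r m k" by auto
  have "\<forall>j<K. r m j \<le> r m k" using k(2)[symmetric] by simp
  hence "leader K (r m) < K \<and> (\<forall>j<K. r m j \<le> r m (leader K (r m)))"
    unfolding leader_def using k(1) by (intro LeastI[of "\<lambda>k. k < K \<and> (\<forall>j<K. r m j \<le> r m k)"]) auto
  thus "leader K (r m) < K" "j < K \<Longrightarrow> r m j \<le> r m (leader K (r m))" by auto
qed

lemma Dl_pos: "0 < Dl m k"
  using Dl_ge[of m k] by (meson less_le_trans zero_less_divide_1_iff zero_less_numeral zero_less_power)

lemma n_base_nonneg: "0 \<le> n_base K (Suc m) (Dl m) k"
  using lambda_pos[of "Suc m"] by (simp add: n_base_def)

lemma n_base_le: "n_base K (Suc m) (Dl m) k \<le> lambda_par K (Suc m) * 4 ^ m"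
proof -
  have "((1 / 2) ^ m) ^ 2 \<le> (Dl m k) ^ 2" using Dl_ge by (intro power_mono) auto
  moreover have "((1 / 2 :: real) ^ m) ^ 2 = 1 / 4 ^ m"
    by (simp add: power_mult[symmetric] power_divide mult.commute[of m])
       (simp add: power_mult)
  ultimately have "1 / 4 ^ m \<le> (Dl m k) ^ 2" by simp
  hence "lambda_par K (Suc m) / (Dl m k) ^ 2 \<le> lambda_par K (Suc m) / (1 / 4 ^ m)"
    using lambda_pos[of "Suc m"] Dl_pos[of m k] by (intro divide_left_mono) auto
  thus ?thesis by (simp add: n_base_def)
qed

text \<open>The other \<open>K - 1\<close> arms take at most \<open>lambda_par * 4 ^ m\<close> each
  out of \<open>N_ep\<close>, which is at least \<open>K\<close> times that. So the leader, too,
  receives no less than its \<open>n_base\<close>.\<close>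

lemma n_tilde_leader_ge:
  "lambda_par K (Suc m) * 4 ^ m \<le> n_tilde K (Suc m) (Dl m) (r m) (leader K (r m))"
proof -
  let ?l = "lambda_par K (Suc m) * 4 ^ m"
  have "(\<Sum>j\<in>{..<K} - {leader K (r m)}. n_base K (Suc m) (Dl m) j)
      \<le> (\<Sum>j\<in>{..<K} - {leader K (r m)}. ?l)"
    by (intro sum_mono n_base_le)
  also have "\<dots> = real K * ?l - ?l"
    using leader_less[of m] K by (simp add: algebra_simps)
  finally show ?thesis using N_ep_ge[of K m] by (simp add: n_tilde_def algebra_simps)
qed

lemma n_tilde_ge: "n_base K (Suc m) (Dl m) k \<le> n_tilde K (Suc m) (Dl m) (r m) k"
  using n_tilde_leader_ge[of m] n_base_le[of m k] by (auto simp: n_tilde_def)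

lemma n_tilde_leader_le: "n_tilde K (Suc m) (Dl m) (r m) (leader K (r m)) \<le> real (N_ep K (Suc m))"
  by (simp add: n_tilde_def sum_nonneg n_base_nonneg)

lemma n_tilde_pos: "0 < n_tilde K (Suc m) (Dl m) (r m) k"
proof -
  have "0 < n_base K (Suc m) (Dl m) k"
    using lambda_pos[of "Suc m"] Dl_pos[of m k] by (simp add: n_base_def)
  thus ?thesis using n_tilde_ge[of m k] by linarith
qed

lemma sum_n_tilde: "(\<Sum>k<K. n_tilde K (Suc m) (Dl m) (r m) k) = real (N_ep K (Suc m))"
proof -
  have "(\<Sum>k<K. n_tilde K (Suc m) (Dl m) (r m) k) = n_tilde K (Suc m) (Dl m) (r m) (leader K (r m))
      + (\<Sum>k\<in>{..<K} - {leader K (r m)}. n_tilde K (Suc m) (Dl m) (r m) k)"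
    using leader_less[of m] by (intro sum.remove) auto
  also have "(\<Sum>k\<in>{..<K} - {leader K (r m)}. n_tilde K (Suc m) (Dl m) (r m) k)
      = (\<Sum>k\<in>{..<K} - {leader K (r m)}. n_base K (Suc m) (Dl m) k)"
    by (intro sum.cong) (auto simp: n_tilde_def)
  finally show ?thesis by (simp add: n_tilde_def)
qed

end

text \<open>A probability-free interface: \<open>e\<close> is an arbitrary additive error per epoch,
  later instantiated by \<open>err\<close>. Index \<open>m\<close> refers to the state after epoch
  \<open>m\<close>; epoch \<open>Suc m\<close> samples according to \<open>Dl m\<close> and
  \<open>r m\<close>.\<close>

locale barbat_run = barbat_core K Dl r
  for K :: nat and Dl r :: "nat \<Rightarrow> nat \<Rightarrow> real" +
  fixes \<mu> :: "nat \<Rightarrow> real" and e :: "nat \<Rightarrow> real"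
  assumes mean01: "\<And>k. k < K \<Longrightarrow> 0 \<le> \<mu> k \<and> \<mu> k \<le> 1"
    and Dl_0: "\<And>k. Dl 0 k = 1"
    and Dl_Suc: "\<And>m k. Dl (Suc m) k =
      max ((1 / 2) ^ Suc m)
        (Max ((\<lambda>k. r (Suc m) k - sqrt (4 * conf K (Suc m) / n_tilde K (Suc m) (Dl m) (r m) k)) ` {..<K})
          - r (Suc m) k)"
    and r01: "\<And>m k. k < K \<Longrightarrow> 0 \<le> r m k \<and> r m k \<le> 1"
    and r_close: "\<And>m k. k < K \<Longrightarrow>
      \<bar>r (Suc m) k - \<mu> k\<bar> \<le> sqrt (4 * conf K (Suc m) / n_tilde K (Suc m) (Dl m) (r m) k) + e (Suc m)"
    and e_nonneg: "\<And>m. 0 \<le> e m"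
begin

text \<open>Indexed by the state that fixes the sample sizes: \<open>width m\<close> belongs to the
  estimates \<open>r (Suc m)\<close>.\<close>

definition width :: "nat \<Rightarrow> nat \<Rightarrow> real" where
  "width m k = sqrt (4 * conf K (Suc m) / n_tilde K (Suc m) (Dl m) (r m) k)"

definition rstar :: "nat \<Rightarrow> real" where
  "rstar m = Max ((\<lambda>k. r (Suc m) k - width m k) ` {..<K})"

definition best :: real where "best = Max (\<mu> ` {..<K})"

definition g :: "nat \<Rightarrow> real" where "g k = best - \<mu> k"

text \<open>The discount 1/8 is that of \<open>width_le\<close>: an error contained in
  \<open>Dl m\<close> enters the next width divided by 8.\<close>

primrec \<rho> :: "nat \<Rightarrow> real" where
  "\<rho> 0 = 0"
| "\<rho> (Suc m) = \<rho> m / 8 + e (Suc m)"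

section \<open>Accuracy of the gap estimates\<close>

lemma Dl_Suc': "Dl (Suc m) k = max ((1 / 2) ^ Suc m) (rstar m - r (Suc m) k)"
  unfolding Dl_Suc rstar_def width_def ..

lemma r_close': "k < K \<Longrightarrow> \<bar>r (Suc m) k - \<mu> k\<bar> \<le> width m k + e (Suc m)"
  unfolding width_def by (rule r_close)

lemma \<rho>_nonneg: "0 \<le> \<rho> m"
  by (induction m) (auto simp: e_nonneg)

lemma best_ge: "k < K \<Longrightarrow> \<mu> k \<le> best"
  by (simp add: best_def)

lemma obtain_best: obtains k where "k < K" "\<mu> k = best"
proof -
  have "best \<in> \<mu> ` {..<K}" unfolding best_def using arms_nonempty by (intro Max_in) auto
  thus ?thesis using that by auto
qed

lemma g_bounds: assumes "k < K" shows "0 \<le> g k \<and> g k \<le> 1"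
proof -
  obtain j where "j < K" "\<mu> j = best" by (rule obtain_best)
  thus ?thesis using best_ge[OF assms] mean01[OF assms] mean01[of j] by (simp add: g_def)
qed

lemma rstar_ge: "k < K \<Longrightarrow> r (Suc m) k - width m k \<le> rstar m"
  unfolding rstar_def by (intro Max_ge) auto

lemma rstar_leI: "(\<And>k. k < K \<Longrightarrow> r (Suc m) k - width m k \<le> x) \<Longrightarrow> rstar m \<le> x"
  unfolding rstar_def using arms_nonempty by (subst Max_le_iff) auto

lemma width_nonneg: "0 \<le> width m k"
proof -
  have "0 \<le> n_tilde K (Suc m) (Dl m) (r m) k"
    using n_tilde_ge[of m k] n_base_nonneg[of m k] by linarith
  thus ?thesis using conf_pos[of "Suc m"] by (simp add: width_def)
qed

lemma Dl_le_1: "k < K \<Longrightarrow> Dl m k \<le> 1"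
proof (cases m)
  case (Suc n)
  assume "k < K"
  have "rstar n \<le> 1"
    by (rule rstar_leI) (use r01 width_nonneg in \<open>smt (verit)\<close>)
  moreover have "(1 / 2 :: real) ^ m \<le> 1" by (simp add: power_le_one)
  ultimately show ?thesis using r01[OF \<open>k < K\<close>, of m] by (simp add: Suc Dl_Suc' del: power_Suc)
qed (simp add: Dl_0)

lemma n_base_ge: "k < K \<Longrightarrow> lambda_par K (Suc m) \<le> n_base K (Suc m) (Dl m) k"
proof -
  assume "k < K"
  hence "(Dl m k) ^ 2 \<le> 1" using Dl_le_1[of k m] Dl_pos[of m k] by (simp add: power_le_one)
  thus ?thesis using Dl_pos[of m k] lambda_pos[of "Suc m"]
    by (simp add: n_base_def pos_le_divide_eq mult_left_le)
qed

lemma width_le: "width m k \<le> Dl m k / 8"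
proof -
  let ?b = "n_base K (Suc m) (Dl m) k"
  have b: "0 < ?b" using lambda_pos[of "Suc m"] Dl_pos[of m k] by (simp add: n_base_def)
  have "4 * conf K (Suc m) / n_tilde K (Suc m) (Dl m) (r m) k \<le> 4 * conf K (Suc m) / ?b"
    using conf_pos[of "Suc m"] b n_tilde_ge[of m k] by (intro divide_left_mono) auto
  also have "\<dots> = (Dl m k / 8) ^ 2"
    using conf_pos[of "Suc m"] Dl_pos[of m k]
    by (simp add: n_base_def lambda_eq_conf[OF K] power2_eq_square field_simps)
  finally have "width m k \<le> sqrt ((Dl m k / 8) ^ 2)"
    unfolding width_def by (rule real_sqrt_le_mono)
  also have "\<dots> = Dl m k / 8" using Dl_pos[of m k] by (subst real_sqrt_abs) simp
  finally show ?thesis .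
qed

text \<open>The recursion is \<open>rstar - r \<le> g + 2 e + Dl / 8\<close>. The coefficients 8/7
  and 2 reproduce themselves under it, as \<open>1 + (8/7) / 8 = 8/7\<close> and
  \<open>2 \<rho> / 8 + 2 e\<close> is twice the next \<open>\<rho>\<close>; the coefficient 4/3
  also covers the floor in the maximum.\<close>

lemma Dl_upper: "k < K \<Longrightarrow> Dl m k \<le> 8 / 7 * g k + 4 / 3 * (1 / 2) ^ m + 2 * \<rho> m"
proof (induction m)
  case 0
  thus ?case using g_bounds[of k] by (simp add: Dl_0)
next
  case (Suc m)
  have "rstar m \<le> best + e (Suc m)"
  proof (rule rstar_leI)
    fix j assume "j < K"
    thus "r (Suc m) j - width m j \<le> best + e (Suc m)"
      using r_close'[of j m] best_ge[of j] by linarith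
  qed
  hence "rstar m - r (Suc m) k \<le> g k + 2 * e (Suc m) + Dl m k / 8"
    using r_close'[OF Suc.prems, of m] width_le[of m k] unfolding g_def by linarith
  moreover have "0 \<le> Dl m k" "0 \<le> (1 / 2 :: real) ^ m" using Dl_pos[of m k] by auto
  moreover note Suc.IH[OF Suc.prems] g_bounds[OF Suc.prems] e_nonneg[of "Suc m"] \<rho>_nonneg[of m]
  moreover have "(1 / 2 :: real) ^ Suc m = (1 / 2) ^ m / 2" by simp
  ultimately have "(1 / 2) ^ Suc m \<le> 8 / 7 * g k + 4 / 3 * (1 / 2) ^ Suc m + 2 * \<rho> (Suc m)"
    "rstar m - r (Suc m) k \<le> 8 / 7 * g k + 4 / 3 * (1 / 2) ^ Suc m + 2 * \<rho> (Suc m)"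
    unfolding \<rho>.simps by argo+
  thus ?case unfolding Dl_Suc' by (rule max.boundedI)
qed

text \<open>The lower confidence bound of a best arm loses two widths, at most
  \<open>Dl m k / 4\<close>, and one error; \<open>Dl_upper\<close> with gap 0 bounds the
  rest.\<close>

lemma rstar_lower: "best - 1 / 3 * (1 / 2) ^ m - \<rho> m / 2 - e (Suc m) \<le> rstar m"
proof -
  obtain k where k: "k < K" "\<mu> k = best" by (rule obtain_best)
  hence "g k = 0" by (simp add: g_def)
  thus ?thesis
    using rstar_ge[OF k(1), of m] r_close'[OF k(1), of m] width_le[of m k] Dl_upper[OF k(1), of m] k(2)
    by linarith
qed

text \<open>For \<open>m > 0\<close> the estimate is at least \<open>6/7 g - 2^-m\<close> minus
  error terms, and at least \<open>2^-m\<close>. Averaging the two removes the floor and halves 6/7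
  to 3/7.\<close>

lemma Dl_lower: assumes "k < K" shows "3 / 7 * g k - 3 * \<rho> m \<le> Dl m k"
proof (cases m)
  case 0
  thus ?thesis using g_bounds[OF assms] by (simp add: Dl_0)
next
  case (Suc n)
  have "rstar n - r (Suc n) k \<le> Dl (Suc n) k" "(1 / 2) ^ Suc n \<le> Dl (Suc n) k"
    unfolding Dl_Suc' by simp_all
  moreover have "(1 / 2 :: real) ^ Suc n = (1 / 2) ^ n / 2" by simp
  moreover note rstar_lower[of n] r_close'[OF assms, of n] width_le[of n k] Dl_upper[OF assms, of n]
    e_nonneg[of "Suc n"] \<rho>_nonneg[of n]
  ultimately show ?thesis unfolding Suc \<rho>.simps g_def by argo
qed

text \<open>Comparing the leader with a best arm bounds its gap by two widths and two errors. The
  width of the leader contributes a seventh of its own gap, which is moved to the left-hand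
  side.\<close>

lemma leader_gap:
  "g (leader K (r (Suc m))) \<le> 7 / 9 * (1 / 2) ^ Suc m + 14 / 3 * \<rho> (Suc m)"
proof -
  let ?l = "leader K (r (Suc m))"
  obtain k where k: "k < K" "\<mu> k = best" by (rule obtain_best)
  hence "g k = 0" by (simp add: g_def)
  moreover have "(1 / 2 :: real) ^ Suc m = (1 / 2) ^ m / 2" by simp
  moreover note leader_less[of "Suc m"] leader_max[OF k(1), of "Suc m"] k(2)
    r_close'[OF k(1), of m] width_le[of m k] Dl_upper[OF k(1), of m]
    r_close'[OF leader_less[of "Suc m"], of m] width_le[of m ?l] Dl_upper[OF leader_less[of "Suc m"], of m]
    e_nonneg[of "Suc m"] \<rho>_nonneg[of m]
  ultimately show ?thesis unfolding \<rho>.simps g_def by argo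
qed

section \<open>Regret of a single epoch\<close>

definition inv_gaps :: real where
  "inv_gaps = (\<Sum>k\<in>{k. k < K \<and> 0 < g k}. 1 / g k)"

text \<open>Asks for some small positive gap rather than for that of the leader, so the value
  depends on the means and on \<open>m\<close> but not on the run.\<close>

definition leader_cost :: "nat \<Rightarrow> real" where
  "leader_cost m = (if 0 < m \<and> (\<exists>k<K. 0 < g k \<and> g k \<le> 7 / 6 * (1 / 2) ^ m)
     then 7 / 6 * (1 / 2) ^ m * real (N_ep K (Suc m)) else 0)"

lemma sum_gap_support: "(\<Sum>k<K. f k * g k) = (\<Sum>k\<in>{k. k < K \<and> 0 < g k}. f k * g k)"
proof (rule sum.mono_neutral_right)
  show "\<forall>k\<in>{..<K} - {k. k < K \<and> 0 < g k}. f k * g k = 0"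
    using g_bounds by force
qed auto

text \<open>Either the gap is at most \<open>14 \<rho>\<close> and the draws are charged to the
  error, or \<open>Dl_lower\<close> gives \<open>Dl \<ge> (3/7 - 3/14) g\<close>. In the latter case
  the constant is \<open>(14/3)^2 = 196/9 \<le> 22\<close>.\<close>

lemma non_leader_cost:
  assumes "k < K" "0 < g k"
  shows "n_base K (Suc m) (Dl m) k * g k
    \<le> 22 * lambda_par K (Suc m) / g k + 14 * \<rho> m * (lambda_par K (Suc m) * 4 ^ m)"
proof (cases "g k \<le> 14 * \<rho> m")
  case True
  have "n_base K (Suc m) (Dl m) k * g k \<le> (lambda_par K (Suc m) * 4 ^ m) * (14 * \<rho> m)"
    using True assms(2) n_base_le[of m k] n_base_nonneg lambda_pos[of "Suc m"]
    by (intro mult_mono) auto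
  moreover have "0 \<le> 22 * lambda_par K (Suc m) / g k"
    using assms(2) lambda_pos[of "Suc m"] by simp
  ultimately show ?thesis by (simp add: mult_ac)
next
  case False
  hence "3 / 14 * g k \<le> Dl m k" using Dl_lower[OF assms(1), of m] by linarith
  hence "(3 / 14 * g k) ^ 2 \<le> (Dl m k) ^ 2" using assms(2) by (intro power_mono) auto
  hence "lambda_par K (Suc m) / (Dl m k) ^ 2 \<le> lambda_par K (Suc m) / (3 / 14 * g k) ^ 2"
    using assms(2) lambda_pos[of "Suc m"] Dl_pos[of m k] by (intro divide_left_mono) auto
  hence "n_base K (Suc m) (Dl m) k * g k \<le> lambda_par K (Suc m) / (3 / 14 * g k) ^ 2 * g k"
    unfolding n_base_def using assms(2) by (intro mult_right_mono) auto
  also have "\<dots> = (196 / 9) * (lambda_par K (Suc m) / g k)"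
    using assms(2) by (simp add: power2_eq_square field_simps)
  also have "\<dots> \<le> 22 * (lambda_par K (Suc m) / g k)"
    using assms(2) lambda_pos[of "Suc m"] by (intro mult_right_mono) auto
  finally have "n_base K (Suc m) (Dl m) k * g k \<le> 22 * lambda_par K (Suc m) / g k" by simp
  moreover have "0 \<le> 14 * \<rho> m * (lambda_par K (Suc m) * 4 ^ m)"
    using \<rho>_nonneg[of m] lambda_pos[of "Suc m"] by simp
  ultimately show ?thesis by linarith
qed

text \<open>The first epoch has no informative leader and is treated directly. Later a positive
  leader gap is due either to errors or to the limited resolution \<open>2^-m\<close>.\<close>

lemma leader_cost_bound:
  defines "l m \<equiv> leader K (r m)"
  assumes "0 < g (l m)"
  shows "n_tilde K (Suc m) (Dl m) (r m) (l m) * g (l m)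
    \<le> 2 * lambda_par K (Suc m) / g (l m) + 14 * \<rho> m * real (N_ep K (Suc m)) + leader_cost m"
proof -
  let ?n = "n_tilde K (Suc m) (Dl m) (r m) (l m)" and ?N = "real (N_ep K (Suc m))"
  have lK: "l m < K" using leader_less l_def by simp
  have n: "?n \<le> ?N" using n_tilde_leader_le l_def by simp
  have p1: "0 \<le> 2 * lambda_par K (Suc m) / g (l m)" using assms(2) lambda_pos[of "Suc m"] by simp
  have p2: "0 \<le> 14 * \<rho> m * ?N" using \<rho>_nonneg[of m] by simp
  have p3: "0 \<le> leader_cost m" by (simp add: leader_cost_def)
  consider "m = 0" | "g (l m) \<le> 14 * \<rho> m" | "0 < m" "\<not> g (l m) \<le> 14 * \<rho> m" by auto
  thus ?thesis
  proof cases
    case 1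
    \<comment> \<open>All gap estimates start at 1, so the leader gets the share of any other arm
      plus at most the unit from the ceiling.\<close>
    have "(\<Sum>j\<in>{..<K} - {l 0}. n_base K (Suc 0) (Dl 0) j) = (\<Sum>j\<in>{..<K} - {l 0}. lambda_par K (Suc 0))"
      by (intro sum.cong) (auto simp: n_base_def Dl_0)
    also have "\<dots> = real K * lambda_par K (Suc 0) - lambda_par K (Suc 0)"
      using lK 1 K by (simp add: algebra_simps)
    finally have "?n \<le> lambda_par K (Suc 0) + 1"
      using N_ep_le_add1[OF K, of 0] 1 by (simp add: n_tilde_def l_def)
    also have "\<dots> \<le> 2 * lambda_par K (Suc 0)" using lambda_ge[OF K, of "Suc 0"] by simp
    finally have "?n * g (l m) \<le> 2 * lambda_par K (Suc 0) * g (l m)"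
      using assms(2) by (intro mult_right_mono) auto
    also have "\<dots> \<le> 2 * lambda_par K (Suc 0) * (1 / g (l m))"
    proof (intro mult_left_mono)
      have "1 \<le> 1 / g (l m)" using g_bounds[OF lK] assms(2) by simp
      thus "g (l m) \<le> 1 / g (l m)" using g_bounds[OF lK] by linarith
    qed (use lambda_pos[of "Suc 0"] in simp)
    finally show ?thesis using p2 p3 1 by simp
  next
    case 2
    have "?n * g (l m) \<le> ?N * (14 * \<rho> m)"
      using 2 n assms(2) by (intro mult_mono) auto
    thus ?thesis using p1 p3 by (simp add: mult_ac)
  next
    case 3
    then obtain j where j: "m = Suc j" by (cases m) auto
    \<comment> \<open>With \<open>\<rho> m < g / 14\<close>, \<open>leader_gap\<close> reads
      \<open>g \<le> 7/9 * 2^-m + g / 3\<close>.\<close>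
    have "g (l m) \<le> 7 / 6 * (1 / 2) ^ m"
      using leader_gap[of j] 3(2) unfolding l_def j by linarith
    hence "leader_cost m = 7 / 6 * (1 / 2) ^ m * ?N" "g (l m) \<le> 7 / 6 * (1 / 2) ^ m"
      using lK assms(2) 3(1) by (auto simp: leader_cost_def)
    moreover have "?n * g (l m) \<le> ?N * (7 / 6 * (1 / 2) ^ m)"
      using calculation(2) n assms(2) by (intro mult_mono) auto
    ultimately show ?thesis using p1 p2 by (simp add: mult_ac)
  qed
qed

lemma leader_cost_nonneg: "0 \<le> leader_cost m"
  by (simp add: leader_cost_def)

text \<open>Charging \<open>14 \<rho> * lambda_par * 4 ^ m\<close> to up to \<open>K\<close> arms
  totals at most \<open>14 \<rho> N\<close>, since \<open>K * lambda_par * 4 ^ m \<le> N\<close>;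
  the leader adds as much again. Only errors of epochs up to \<open>m\<close> enter the regret of
  epoch \<open>Suc m\<close>.\<close>

lemma epoch_regret:
  "(\<Sum>k<K. n_tilde K (Suc m) (Dl m) (r m) k * g k)
    \<le> 44 * lambda_par K (Suc m) * inv_gaps + 28 * \<rho> m * real (N_ep K (Suc m)) + leader_cost m"
proof -
  let ?l = "leader K (r m)" and ?N = "real (N_ep K (Suc m))" and ?lam = "lambda_par K (Suc m)"
  let ?n = "n_tilde K (Suc m) (Dl m) (r m)"
  let ?S = "{k. k < K \<and> 0 < g k}"
  have fin: "finite ?S" by simp
  have pt: "?n k * g k \<le> (22 * ?lam / g k + 14 * \<rho> m * (?lam * 4 ^ m))
      + (if k = ?l then 14 * \<rho> m * ?N + leader_cost m else 0)" if k: "k \<in> ?S" for k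
  proof (cases "k = ?l")
    case True
    have "2 * ?lam / g ?l \<le> 22 * ?lam / g ?l"
      using k True lambda_pos[of "Suc m"] by (intro divide_right_mono) auto
    moreover have "0 \<le> 14 * \<rho> m * (?lam * 4 ^ m)"
      using \<rho>_nonneg[of m] lambda_pos[of "Suc m"] by simp
    ultimately show ?thesis using leader_cost_bound[of m] k True by simp
  next
    case False
    thus ?thesis using non_leader_cost[of k m] k by (simp add: n_tilde_def)
  qed
  have "(\<Sum>k<K. ?n k * g k) = (\<Sum>k\<in>?S. ?n k * g k)" by (rule sum_gap_support)
  also have "\<dots> \<le> (\<Sum>k\<in>?S. (22 * ?lam / g k + 14 * \<rho> m * (?lam * 4 ^ m))
      + (if k = ?l then 14 * \<rho> m * ?N + leader_cost m else 0))"
    by (intro sum_mono pt)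
  also have "\<dots> = 22 * ?lam * inv_gaps + real (card ?S) * (14 * \<rho> m * (?lam * 4 ^ m))
      + (\<Sum>k\<in>?S. if k = ?l then 14 * \<rho> m * ?N + leader_cost m else 0)"
    by (simp add: sum.distrib inv_gaps_def sum_distrib_left)
  also have "(\<Sum>k\<in>?S. if k = ?l then 14 * \<rho> m * ?N + leader_cost m else 0)
      \<le> 14 * \<rho> m * ?N + leader_cost m"
    using fin \<rho>_nonneg[of m] leader_cost_nonneg[of m] by simp
  also have "real (card ?S) * (14 * \<rho> m * (?lam * 4 ^ m)) \<le> real K * (14 * \<rho> m * (?lam * 4 ^ m))"
    using \<rho>_nonneg[of m] lambda_pos[of "Suc m"] card_mono[of "{..<K}" ?S]
    by (intro mult_right_mono) auto
  also have "real K * (14 * \<rho> m * (?lam * 4 ^ m)) = 14 * \<rho> m * (real K * ?lam * 4 ^ m)" by simp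
  also have "\<dots> \<le> 14 * \<rho> m * ?N"
    using N_ep_ge[of K m] \<rho>_nonneg[of m] by (intro mult_left_mono) auto
  finally have *: "(\<Sum>k<K. ?n k * g k)
      \<le> 22 * ?lam * inv_gaps + 14 * \<rho> m * ?N + (14 * \<rho> m * ?N + leader_cost m)"
    by linarith
  have "0 \<le> ?lam * inv_gaps"
    unfolding inv_gaps_def using lambda_pos[of "Suc m"] by (intro mult_nonneg_nonneg sum_nonneg) auto
  with * show ?thesis by linarith
qed

section \<open>Summation over the epochs\<close>

lemma \<rho>_weighted_sum:
  "(\<Sum>m<M. \<rho> m * real (N_ep K (Suc m))) + 4 * (\<rho> M * real (N_ep K (Suc M)))
    \<le> 24 * (\<Sum>m\<in>{1..M}. real (N_ep K m) * e m)"
proof (induction M)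
  case (Suc M)
  \<comment> \<open>The second summand of the claim is a potential: growth 6 against discount 8
    contracts it by 3/4. Its weight 4 solves \<open>1 + 3/4 * 4 = 4\<close>, and the new error costs
    \<open>4 * 6 = 24\<close>.\<close>
  have "\<rho> (Suc M) * real (N_ep K (Suc (Suc M))) \<le> \<rho> (Suc M) * (6 * real (N_ep K (Suc M)))"
    using \<rho>_nonneg N_ep_Suc_le[OF K] by (intro mult_left_mono)
  also have "\<dots> = 3 / 4 * (\<rho> M * real (N_ep K (Suc M))) + 6 * (real (N_ep K (Suc M)) * e (Suc M))"
    by (simp add: algebra_simps)
  finally show ?case using Suc by (simp del: \<rho>.simps(2))
qed simp

lemma \<rho>_weighted_sum_le:
  "(\<Sum>m<Suc M. \<rho> m * real (N_ep K (Suc m))) \<le> 24 * (\<Sum>m\<in>{1..M}. real (N_ep K m) * e m)"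
  using \<rho>_weighted_sum[of M] mult_nonneg_nonneg[OF \<rho>_nonneg[of M], of "real (N_ep K (Suc M))"] by simp

lemma inv_gaps_ge_1:
  assumes "k < K" "0 < g k" shows "1 \<le> inv_gaps"
proof -
  have "1 \<le> 1 / g k" using assms g_bounds[of k] by simp
  also have "\<dots> \<le> inv_gaps"
    unfolding inv_gaps_def using assms by (intro member_le_sum) auto
  finally show ?thesis .
qed

lemma inv_gaps_nonneg: "0 \<le> inv_gaps"
  unfolding inv_gaps_def by (intro sum_nonneg) auto

text \<open>Such a sum is below twice its last nonzero term, and that term is at most
  \<open>B\<close>.\<close>

lemma geometric_cutoff_sum:
  fixes B :: real assumes "0 \<le> B"
  shows "(\<Sum>m<M. if 2 ^ m \<le> B then 2 ^ m else 0) \<le> 2 * B"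
proof -
  have *: "(\<Sum>m<M. if 2 ^ m \<le> B then 2 ^ m else 0) \<le> (2 ^ M - 1 :: real)"
    (is "?s M \<le> _") for M
    by (induction M) (auto intro: order_trans)
  show ?thesis
  proof (induction M)
    case (Suc M)
    show ?case
    proof (cases "2 ^ M \<le> B")
      case True
      thus ?thesis using *[of M] by simp
    qed (use Suc in simp)
  qed (use assms in simp)
qed

lemma leader_cost_le:
  assumes d: "0 < d" "d \<le> 1" "\<And>k. k < K \<Longrightarrow> 0 < g k \<Longrightarrow> d \<le> g k"
  shows "leader_cost m \<le> (if 2 ^ m \<le> 7 / (6 * d) then 2 ^ m else 0)
    * (7 / 3 * 65536 * (real K * ln (1 / d) * ln (real K / d)))"
proof (cases "0 < m \<and> (\<exists>k<K. 0 < g k \<and> g k \<le> 7 / 6 * (1 / 2) ^ m)")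
  case False
  have "0 \<le> ln (1 / d)" "0 \<le> ln (real K / d)"
    using d K by (simp_all add: pos_le_divide_eq)
  hence "0 \<le> real K * ln (1 / d) * ln (real K / d)" by simp
  thus ?thesis using False by (auto simp: leader_cost_def)
next
  case True
  define u where "u = ln (1 / d)"
  have "d \<le> 7 / 6 * (1 / 2) ^ m" using True d(3) by force
  hence B: "2 ^ m \<le> 7 / (6 * d)"
    using d(1) by (simp add: field_simps)
  have "(2::real) ^ 1 \<le> 2 ^ m" using True by (intro power_increasing) auto
  hence "2 \<le> 7 / (6 * d)" using B by simp
  hence "7 / 6 \<le> 1 / d" using d(1) by (simp add: field_simps)
  \<comment> \<open>Squaring \<open>1 / d\<close> swallows the factor 7/6, so that \<open>m\<close>
    is bounded by a multiple of \<open>ln (1 / d)\<close> without an additive constant. This matters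
    for \<open>d\<close> near 1, where the logarithm vanishes.\<close>
  hence "7 / 6 * (1 / d) \<le> (1 / d) * (1 / d)" using d(1) by (intro mult_right_mono) auto
  hence sq: "2 ^ m \<le> (1 / d) ^ 2" using B d(1) by (simp add: power2_eq_square)
  hence "ln (2 ^ m) \<le> ln ((1 / d) ^ 2)" by (intro ln_mono) auto
  hence mu: "real m * ln 2 \<le> 2 * u"
    unfolding u_def using ln_realpow[of "2::real" m] ln_realpow[of "1 / d" 2] d(1) by simp
  have "real m * (1 / 2) \<le> real m * ln 2" using ln2_ge by (intro mult_left_mono) auto
  hence m4: "real m \<le> 4 * u" using mu by linarith
  have u4: "1 \<le> 4 * u" using m4 True by simp
  have lnK: "1 / 2 \<le> ln (real K)" by (rule ln_arms_ge[OF K])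
  have Kd: "ln (real K / d) = ln (real K) + u"
    unfolding u_def using d(1) K by (simp add: ln_div)
  have "lambda_par K (Suc m) \<le> 4096 * (ln (real K) + real (Suc m))"
    using lambda_le[OF K, of "Suc m"] by simp
  also have "\<dots> \<le> 16384 * ln (real K / d)" using m4 lnK unfolding Kd by simp
  finally have lam: "lambda_par K (Suc m) \<le> 16384 * ln (real K / d)" .
  have "(1 / 2 :: real) ^ m * 4 ^ m = (1 / 2 * 4) ^ m" by (rule power_mult_distrib[symmetric])
  hence pw: "(1 / 2 :: real) ^ m * 4 ^ m = 2 ^ m" by simp
  have "leader_cost m = 7 / 6 * (1 / 2) ^ m * real (N_ep K (Suc m))"
    using True by (simp add: leader_cost_def)
  also have "\<dots> \<le> 7 / 6 * (1 / 2) ^ m * (2 * (real K * lambda_par K (Suc m) * 4 ^ m))"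
    by (intro mult_left_mono N_ep_le[OF K]) auto
  also have "\<dots> = 7 / 3 * real K * lambda_par K (Suc m) * ((1 / 2) ^ m * 4 ^ m)" by simp
  also have "\<dots> = 7 / 3 * real K * lambda_par K (Suc m) * 2 ^ m" unfolding pw ..
  also have "\<dots> \<le> 7 / 3 * real K * (16384 * ln (real K / d)) * 2 ^ m"
    by (intro mult_right_mono mult_left_mono lam) auto
  \<comment> \<open>The factor \<open>ln (1 / d)\<close> enters here, through
    \<open>1 \<le> 4 * u\<close>, which holds because \<open>m \<ge> 1\<close>.\<close>
  also have "\<dots> \<le> 7 / 3 * real K * (16384 * ln (real K / d)) * 2 ^ m * (4 * u)"
  proof -
    have "0 \<le> 7 / 3 * real K * (16384 * ln (real K / d)) * 2 ^ m"
      using lam lambda_pos[of "Suc m"] by simp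
    from mult_left_mono[OF u4 this] show ?thesis by simp
  qed
  finally show ?thesis using B by (simp add: u_def mult_ac)
qed

lemma leader_cost_sum:
  assumes d: "0 < d" "d \<le> 1" "\<And>k. k < K \<Longrightarrow> 0 < g k \<Longrightarrow> d \<le> g k"
  shows "(\<Sum>m<M. leader_cost m) \<le> 393216 * (real K * ln (1 / d) * ln (real K / d) / d)"
proof -
  let ?X = "real K * ln (1 / d) * ln (real K / d)"
  have "0 \<le> ln (1 / d)" "0 \<le> ln (real K / d)"
    using d K by (simp_all add: pos_le_divide_eq)
  hence X: "0 \<le> ?X" by simp
  have "(\<Sum>m<M. leader_cost m) \<le>
      (\<Sum>m<M. (if 2 ^ m \<le> 7 / (6 * d) then 2 ^ m else 0) * (7 / 3 * 65536 * ?X))"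
    by (intro sum_mono leader_cost_le d)
  also have "\<dots> = (\<Sum>m<M. (if 2 ^ m \<le> 7 / (6 * d) then 2 ^ m else 0)) * (7 / 3 * 65536 * ?X)"
    by (rule sum_distrib_right[symmetric])
  also have "\<dots> \<le> 2 * (7 / (6 * d)) * (7 / 3 * 65536 * ?X)"
    using X d by (intro mult_right_mono geometric_cutoff_sum) auto
  also have "\<dots> = 49 / 9 * 65536 * (?X / d)" by simp
  also have "\<dots> \<le> 393216 * (?X / d)" using X d by (intro mult_right_mono) auto
  finally show ?thesis .
qed

text \<open>There are at most \<open>3 ln T\<close> epochs, and the largest
  \<open>lambda_par\<close> is the last one, giving \<open>3 * 44 * 12288 = 1622016\<close>. The
  error weight is \<open>28 * 24 = 672\<close>.\<close>

lemma run_regret: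
  assumes T: "2 \<le> T" "T_ep K M < T"
    and d: "0 < d" "d \<le> 1" "\<And>k. k < K \<Longrightarrow> 0 < g k \<Longrightarrow> d \<le> g k"
  shows "(\<Sum>m<Suc M. \<Sum>k<K. n_tilde K (Suc m) (Dl m) (r m) k * g k)
    \<le> 1622016 * (ln (real T) * ln (real K * real T) * inv_gaps)
      + 393216 * (real K * ln (1 / d) * ln (real K / d) / d)
      + 672 * (\<Sum>m\<in>{1..M}. real (N_ep K m) * e m)"
proof -
  have M: "real (Suc M) \<le> 3 * ln (real T)" by (rule epoch_count_le[OF K T])
  have lnK: "0 \<le> ln (real K)" using ln_arms_ge[OF K] by linarith
  have lnT: "0 \<le> ln (real T)" using T by simp
  have lnKT: "ln (real K * real T) = ln (real K) + ln (real T)"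
    using K T by (simp add: ln_mult)
  have "lambda_par K (Suc M) \<le> 4096 * (ln (real K) + real (Suc M))"
    by (rule lambda_le[OF K]) simp
  also have "\<dots> \<le> 12288 * ln (real K * real T)" using M lnK unfolding lnKT by simp
  finally have lam: "lambda_par K (Suc M) \<le> 12288 * ln (real K * real T)" .
  have "(\<Sum>m<Suc M. \<Sum>k<K. n_tilde K (Suc m) (Dl m) (r m) k * g k)
      \<le> (\<Sum>m<Suc M. 44 * lambda_par K (Suc m) * inv_gaps
          + 28 * \<rho> m * real (N_ep K (Suc m)) + leader_cost m)"
    by (intro sum_mono epoch_regret)
  also have "\<dots> = (\<Sum>m<Suc M. 44 * lambda_par K (Suc m) * inv_gaps)
      + 28 * (\<Sum>m<Suc M. \<rho> m * real (N_ep K (Suc m))) + (\<Sum>m<Suc M. leader_cost m)"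
    by (simp only: sum.distrib sum_distrib_left mult.assoc)
  also have "(\<Sum>m<Suc M. 44 * lambda_par K (Suc m) * inv_gaps)
      \<le> (\<Sum>m<Suc M. 44 * lambda_par K (Suc M) * inv_gaps)"
    using lambda_mono[OF K] inv_gaps_nonneg by (intro sum_mono mult_right_mono) auto
  also have "\<dots> = real (Suc M) * (44 * lambda_par K (Suc M) * inv_gaps)" by simp
  also have "\<dots> \<le> 3 * ln (real T) * (44 * (12288 * ln (real K * real T)) * inv_gaps)"
    using M lam lambda_pos[of "Suc M"] inv_gaps_nonneg lnT
    by (intro mult_mono mult_right_mono mult_left_mono) auto
  also have "\<dots> = 1622016 * (ln (real T) * ln (real K * real T) * inv_gaps)" by simp
  also note leader_cost_sum[OF d]
  also note \<rho>_weighted_sum_le[of M]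
  finally show ?thesis by simp
qed

end

subsection \<open>Exponential moments of one round\<close>

text \<open>A quadratic coefficient below 1 leaves part of the penalty \<open>\<theta>^2 p\<close>
  of a round for the randomness of the rewards.\<close>

lemma exp_le_quadratic:
  assumes "\<bar>y::real\<bar> \<le> 1 / 4" shows "exp y \<le> 1 + y + 3 / 4 * y\<^sup>2"
proof -
  obtain t where t: "\<bar>t\<bar> \<le> \<bar>y\<bar>" "exp y = (\<Sum>m<2. y ^ m / fact m) + exp t / fact 2 * y ^ 2"
    using Maclaurin_exp_le[of y 2] by auto
  have "exp t \<le> exp (1 / 4 :: real)" using t(1) assms by simp
  also have "\<dots> \<le> 1 + 1 / 4 + (1 / 4)\<^sup>2" by (rule exp_bound) auto
  also have "\<dots> \<le> 3 / 2" by (simp add: power2_eq_square)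
  finally have "exp t / 2 * y\<^sup>2 \<le> 3 / 4 * y\<^sup>2" by (intro mult_right_mono) auto
  thus ?thesis using t(2) by (simp add: numeral_2_eq_2)
qed

text \<open>Hoeffding's lemma for either sign of the parameter; a negative one is handled by passing
  to \<open>- f\<close> on \<open>[-1, 0]\<close>.\<close>

lemma nn_integral_exp_centered_le:
  fixes l :: real
  assumes "prob_space M" and f: "f \<in> borel_measurable M" and b: "AE x in M. 0 \<le> f x \<and> f x \<le> 1"
  shows "(\<integral>\<^sup>+x. exp (l * (f x - (\<integral>x. f x \<partial>M))) \<partial>M) \<le> ennreal (exp (l\<^sup>2 / 8))"
proof -
  interpret prob_space M by fact
  consider "l = 0" | "0 < l" | "l < 0" by linarith
  thus ?thesis
  proof cases
    case 1
    thus ?thesis by (simp add: emeasure_space_1)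
  next
    case 2
    interpret X: interval_bounded_random_variable M f 0 1
      by unfold_locales (use f b in auto)
    show ?thesis using X.Hoeffdings_lemma_nn_integral[OF 2] by simp
  next
    case 3
    interpret X: interval_bounded_random_variable M "\<lambda>x. - f x" "-1" 0
      by unfold_locales (use f b in auto)
    have "(\<integral>\<^sup>+x. exp (- l * (- f x - (\<integral>x. - f x \<partial>M))) \<partial>M) \<le> ennreal (exp ((- l)\<^sup>2 / 8))"
      using X.Hoeffdings_lemma_nn_integral[of "- l"] 3 by simp
    thus ?thesis by (simp add: algebra_simps)
  qed
qed

text \<open>Takes the place of conditional expectation: replacing one coordinate by an independent
  copy preserves the product law, and the inner integral conditions on all other
  coordinates.\<close>

lemma nn_integral_PiM_resample:
  fixes f :: "('i \<Rightarrow> 'a) \<Rightarrow> ennreal"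
  assumes X: "prob_space X" and f: "f \<in> borel_measurable (PiM UNIV (\<lambda>_. X))"
  shows "(\<integral>\<^sup>+\<omega>. f \<omega> \<partial>PiM UNIV (\<lambda>_. X)) = (\<integral>\<^sup>+\<omega>. (\<integral>\<^sup>+x. f (fun_upd \<omega> t x) \<partial>X) \<partial>PiM UNIV (\<lambda>_. X))"
proof -
  let ?P = "PiM UNIV (\<lambda>_::'i. X)"
  interpret X: prob_space X by fact
  interpret P: prob_space ?P by (rule prob_space_PiM) (rule X)
  interpret XP: pair_sigma_finite X ?P ..
  have m: "(\<lambda>(x, \<omega>). fun_upd \<omega> t x) \<in> measurable (X \<Otimes>\<^sub>M ?P) ?P"
    using measurable_fun_upd[of UNIV UNIV t snd "X \<Otimes>\<^sub>M ?P" "\<lambda>_. X" fst]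
    by (simp add: case_prod_beta')
  have "distr (X \<Otimes>\<^sub>M ?P) ?P (\<lambda>(x, \<omega>). fun_upd \<omega> t x) = ?P"
    using distr_pair_PiM_eq_PiM[of UNIV "\<lambda>_. X" t] X by simp
  hence "(\<integral>\<^sup>+\<omega>. f \<omega> \<partial>?P) = (\<integral>\<^sup>+\<omega>. f \<omega> \<partial>distr (X \<Otimes>\<^sub>M ?P) ?P (\<lambda>(x, \<omega>). fun_upd \<omega> t x))" by simp
  also have "\<dots> = (\<integral>\<^sup>+z. f ((\<lambda>(x, \<omega>). fun_upd \<omega> t x) z) \<partial>(X \<Otimes>\<^sub>M ?P))"
    using m f by (intro nn_integral_distr) auto
  also have "\<dots> = (\<integral>\<^sup>+\<omega>. (\<integral>\<^sup>+x. f (fun_upd \<omega> t x) \<partial>X) \<partial>?P)"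
    using XP.nn_integral_snd[OF measurable_compose[OF m f]] by simp
  finally show ?thesis .
qed

section \<open>Drawing an arm from a uniform seed\<close>

abbreviation unif :: "real measure" where "unif \<equiv> uniform_measure lborel {0..1::real}"

lemma prob_space_unif: "prob_space unif"
  by (intro prob_space_uniform_measure) auto

lemma choose_arm_less: "0 < K \<Longrightarrow> choose_arm K p u < K"
proof (cases "\<exists>k<K. u < (\<Sum>j\<le>k. p j)")
  case True
  then obtain k where "k < K" "u < (\<Sum>j\<le>k. p j)" by blast
  thus ?thesis using Least_le[of "\<lambda>k. u < (\<Sum>j\<le>k. p j)" k] True by (simp add: choose_arm_def)
qed (auto simp: choose_arm_def)

lemma choose_arm_eqI:
  assumes p: "\<And>j. j < K \<Longrightarrow> 0 \<le> p j" and k: "k < K"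
    and u: "(\<Sum>j<k. p j) \<le> u" "u < (\<Sum>j<Suc k. p j)"
  shows "choose_arm K p u = k"
proof -
  have "(LEAST k. u < (\<Sum>j\<le>k. p j)) = k"
  proof (rule Least_equality)
    show "u < (\<Sum>j\<le>k. p j)" using u(2) by (simp add: lessThan_Suc_atMost)
    fix i assume i: "u < (\<Sum>j\<le>i. p j)"
    show "k \<le> i"
    proof (rule ccontr)
      assume "\<not> k \<le> i"
      hence "(\<Sum>j\<le>i. p j) \<le> (\<Sum>j<k. p j)" using p k by (intro sum_mono2) auto
      thus False using i u(1) by linarith
    qed
  qed
  moreover have "\<exists>k<K. u < (\<Sum>j\<le>k. p j)" using k u(2) by (auto simp: lessThan_Suc_atMost)
  ultimately show ?thesis by (simp add: choose_arm_def)
qed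

lemma measurable_choose_arm [measurable]:
  assumes [measurable]: "\<And>j. (\<lambda>x. p x j) \<in> borel_measurable M" "u \<in> borel_measurable M"
  shows "(\<lambda>x. choose_arm K (p x) (u x)) \<in> measurable M (count_space UNIV)"
  unfolding choose_arm_def by measurable

text \<open>The seeds selecting arm \<open>k\<close> form the interval between consecutive partial
  sums of \<open>p\<close>, whose length is \<open>p k\<close>.\<close>

lemma nn_integral_choose_arm:
  fixes f :: "nat \<Rightarrow> ennreal"
  assumes p: "\<And>j. j < K \<Longrightarrow> 0 \<le> p j" and p1: "(\<Sum>j<K. p j) = 1"
  shows "(\<integral>\<^sup>+u. f (choose_arm K p u) \<partial>unif) = (\<Sum>k<K. ennreal (p k) * f k)"
proof -
  define c where "c k = (\<Sum>j<k. p j)" for k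
  have cm: "c i \<le> c j" if "i \<le> j" "j \<le> K" for i j
    unfolding c_def using that p by (intro sum_mono2) auto
  have c0: "c 0 = 0" and cK: "c K = 1" using p1 by (auto simp: c_def)
  have eq: "f (choose_arm K p u) = (\<Sum>k<K. f k * indicator {c k..<c (Suc k)} u)"
    if u: "0 \<le> u" "u < 1" for u
  proof -
    define k where "k = (LEAST k. u < c (Suc k))"
    have "u < c (Suc (K - 1))" using u cK c0 by (cases K) auto
    hence k1: "u < c (Suc k)" and kK: "k \<le> K - 1"
      unfolding k_def by (auto intro: LeastI Least_le)
    have kK: "k < K" using kK cK c0 by (cases K) auto
    have k2: "c k \<le> u"
    proof (cases k)
      case (Suc i)
      thus ?thesis using not_less_Least[of i "\<lambda>k. u < c (Suc k)"] k_def by auto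
    qed (use u c0 in simp)
    have "indicator {c j..<c (Suc j)} u = (if j = k then 1 else 0 :: ennreal)" if "j < K" for j
    proof -
      consider "j = k" | "Suc j \<le> k" | "Suc k \<le> j" by linarith
      thus ?thesis
      proof cases
        case 2
        thus ?thesis using cm[of "Suc j" k] kK k2 by auto
      next
        case 3
        thus ?thesis using cm[of "Suc k" j] that k1 by auto
      qed (use k1 k2 in auto)
    qed
    hence "(\<Sum>j<K. f j * indicator {c j..<c (Suc j)} u) = (\<Sum>j<K. f j * (if j = k then 1 else 0))"
      by (intro sum.cong) auto
    also have "\<dots> = f k" using kK by (simp add: if_distrib cong: if_cong)
    finally show ?thesis using choose_arm_eqI[OF p kK] k1 k2 by (simp add: c_def)
  qed
  \<comment> \<open>The half-open intervals miss the endpoint 1, a null set.\<close>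
  have "AE u in unif. 0 \<le> u \<and> u < 1"
  proof -
    have "AE u in lborel. u \<noteq> (1::real)" by (rule AE_lborel_singleton)
    hence "AE u in lborel. u \<in> {0..1} \<longrightarrow> 0 \<le> u \<and> u < (1::real)" by eventually_elim auto
    thus ?thesis by (subst AE_uniform_measure) auto
  qed
  hence "AE u in unif. f (choose_arm K p u) = (\<Sum>k<K. f k * indicator {c k..<c (Suc k)} u)"
    by eventually_elim (use eq in blast)
  hence "(\<integral>\<^sup>+u. f (choose_arm K p u) \<partial>unif)
      = (\<integral>\<^sup>+u. (\<Sum>k<K. f k * indicator {c k..<c (Suc k)} u) \<partial>unif)"
    by (rule nn_integral_cong_AE)
  also have "\<dots> = (\<Sum>k<K. f k * emeasure unif {c k..<c (Suc k)})"
    by (subst nn_integral_sum) (auto simp: nn_integral_cmult_indicator)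
  also have "\<dots> = (\<Sum>k<K. ennreal (p k) * f k)"
  proof (intro sum.cong refl)
    fix k assume k: "k \<in> {..<K}"
    have "0 \<le> c k" "c (Suc k) \<le> 1" "c k \<le> c (Suc k)"
      using cm[of 0 k] cm[of "Suc k" K] cm[of k "Suc k"] c0 cK k by auto
    hence "{0..1} \<inter> {c k..<c (Suc k)} = {c k..<c (Suc k)}" by auto
    hence "emeasure unif {c k..<c (Suc k)} = ennreal (c (Suc k) - c k)"
      using \<open>c k \<le> c (Suc k)\<close> by (simp add: divide_ennreal_def)
    also have "c (Suc k) - c k = p k" by (simp add: c_def)
    finally show "f k * emeasure unif {c k..<c (Suc k)} = ennreal (p k) * f k"
      by (simp add: mult.commute)
  qed
  finally show ?thesis .
qed

lemma measurable_component_vec [measurable]: "(\<lambda>x. x k) \<in> borel_measurable vec_space"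
  unfolding vec_space_def by measurable

text \<open>The draw is Bernoulli for a fixed reward vector. Its exponential moment uses 3/4 of the
  penalty \<open>\<theta>^2 p\<close>, the term with \<open>c\<close> pays for replacing the
  corrupted \<open>y\<close> by the true \<open>x\<close>, and the remaining quarter is kept as a
  gain.\<close>

lemma bernoulli_exp_le:
  fixes p x y \<theta> \<mu> c :: real
  assumes p: "0 \<le> p" "p \<le> 1" and y: "0 \<le> y" "y \<le> 1" and c: "\<bar>y - x\<bar> \<le> c" and \<theta>: "\<bar>\<theta>\<bar> \<le> 1 / 4"
  shows "p * exp (\<theta> * (y - p * \<mu>) - \<bar>\<theta>\<bar> * p * c - \<theta>\<^sup>2 * p)
      + (1 - p) * exp (\<theta> * (0 - p * \<mu>) - \<bar>\<theta>\<bar> * p * c - \<theta>\<^sup>2 * p)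
    \<le> exp (- (\<theta>\<^sup>2 * p) / 4) * exp (p * \<theta> * (x - \<mu>))"
proof -
  define E where "E = exp (- \<theta> * p * \<mu> - \<bar>\<theta>\<bar> * p * c - \<theta>\<^sup>2 * p)"
  have "\<bar>\<theta> * y\<bar> \<le> 1 / 4 * 1" unfolding abs_mult using \<theta> y by (intro mult_mono) auto
  hence "exp (\<theta> * y) \<le> 1 + \<theta> * y + 3 / 4 * (\<theta> * y)\<^sup>2" by (intro exp_le_quadratic) simp
  also have "(\<theta> * y)\<^sup>2 \<le> \<theta>\<^sup>2" using y by (simp add: power_mult_distrib mult_left_le power_le_one)
  finally have "p * (exp (\<theta> * y) - 1) \<le> p * (\<theta> * y + 3 / 4 * \<theta>\<^sup>2)"
    using p by (intro mult_left_mono) auto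
  hence "p * exp (\<theta> * y) + (1 - p) \<le> 1 + p * (\<theta> * y + 3 / 4 * \<theta>\<^sup>2)" by (simp add: algebra_simps)
  also have "\<dots> \<le> exp (p * (\<theta> * y + 3 / 4 * \<theta>\<^sup>2))" by (rule exp_ge_add_one_self)
  finally have *: "p * exp (\<theta> * y) + (1 - p) \<le> exp (p * (\<theta> * y + 3 / 4 * \<theta>\<^sup>2))" .
  have "\<theta> * (y - x) \<le> \<bar>\<theta> * (y - x)\<bar>" by (rule abs_ge_self)
  also have "\<dots> = \<bar>\<theta>\<bar> * \<bar>y - x\<bar>" by (rule abs_mult)
  also have "\<dots> \<le> \<bar>\<theta>\<bar> * c" using c by (intro mult_left_mono) auto
  finally have "p * (\<theta> * (y - x)) \<le> p * (\<bar>\<theta>\<bar> * c)" using p by (intro mult_left_mono) auto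
  hence **: "(- \<theta> * p * \<mu> - \<bar>\<theta>\<bar> * p * c - \<theta>\<^sup>2 * p) + p * (\<theta> * y + 3 / 4 * \<theta>\<^sup>2)
      \<le> - (\<theta>\<^sup>2 * p) / 4 + p * \<theta> * (x - \<mu>)" by (simp add: algebra_simps)
  have "p * exp (\<theta> * (y - p * \<mu>) - \<bar>\<theta>\<bar> * p * c - \<theta>\<^sup>2 * p)
      + (1 - p) * exp (\<theta> * (0 - p * \<mu>) - \<bar>\<theta>\<bar> * p * c - \<theta>\<^sup>2 * p) = E * (p * exp (\<theta> * y) + (1 - p))"
    unfolding E_def by (simp add: algebra_simps flip: exp_add)
  also have "\<dots> \<le> E * exp (p * (\<theta> * y + 3 / 4 * \<theta>\<^sup>2))"
    using * by (intro mult_left_mono) (auto simp: E_def)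
  also have "\<dots> = exp ((- \<theta> * p * \<mu> - \<bar>\<theta>\<bar> * p * c - \<theta>\<^sup>2 * p) + p * (\<theta> * y + 3 / 4 * \<theta>\<^sup>2))"
    unfolding E_def by (rule exp_add[symmetric])
  also have "\<dots> \<le> exp (- (\<theta>\<^sup>2 * p) / 4 + p * \<theta> * (x - \<mu>))" using ** by simp
  finally show ?thesis by (simp only: exp_add)
qed

text \<open>The corrupted vector \<open>y\<close> may depend on the reward vector but not on the arm
  being drawn. So the seed is integrated out first, for a fixed reward vector, and Hoeffding's lemma
  is applied to the rewards afterwards.\<close>

lemma one_round_exp_le:
  assumes D: "valid_reward_dist K D"
    and p: "\<And>j. j < K \<Longrightarrow> 0 \<le> p j" "(\<Sum>j<K. p j) = 1" and k: "k < K"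
    and y: "y \<in> measurable vec_space vec_space" "\<And>x j. j < K \<Longrightarrow> 0 \<le> y x j \<and> y x j \<le> 1"
    and \<theta>: "\<bar>\<theta>\<bar> \<le> 1 / 4"
  shows "(\<integral>\<^sup>+z. ennreal (exp (\<theta> * ((if choose_arm K p (snd z) = k then y (fst z) k else 0) - p k * mean D k)
      - \<bar>\<theta>\<bar> * p k * Max ((\<lambda>j. \<bar>y (fst z) j - fst z j\<bar>) ` {..<K}) - \<theta>\<^sup>2 * p k)) \<partial>(D \<Otimes>\<^sub>M unif)) \<le> 1"
proof -
  interpret D: prob_space D using D by (simp add: valid_reward_dist_def)
  interpret U: prob_space unif by (rule prob_space_unif)
  have sD: "sets D = sets vec_space" and b: "AE x in D. \<forall>k<K. 0 \<le> x k \<and> x k \<le> 1"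
    using D by (auto simp: valid_reward_dist_def)
  have [measurable]: "(\<lambda>x. x j) \<in> borel_measurable D" for j
    using measurable_component_vec by (simp add: measurable_cong_sets[OF sD refl])
  have yj: "(\<lambda>x. y x j) \<in> borel_measurable D" for j
    using measurable_compose[OF y(1) measurable_component_vec] by (simp add: measurable_cong_sets[OF sD refl])
  note yj[measurable]
  have pk: "0 \<le> p k" "p k \<le> 1"
    using p(1)[OF k] member_le_sum[of k "{..<K}" p] p k by auto
  let ?c = "\<lambda>x. Max ((\<lambda>j. \<bar>y x j - x j\<bar>) ` {..<K})"
  let ?h = "\<lambda>x i. exp (\<theta> * ((if i = k then y x k else 0) - p k * mean D k)
      - \<bar>\<theta>\<bar> * p k * ?c x - \<theta>\<^sup>2 * p k)"
  have "(\<integral>\<^sup>+z. ennreal (?h (fst z) (choose_arm K p (snd z))) \<partial>(D \<Otimes>\<^sub>M unif))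
      = (\<integral>\<^sup>+x. (\<integral>\<^sup>+u. ennreal (?h x (choose_arm K p u)) \<partial>unif) \<partial>D)"
    by (subst U.nn_integral_fst[symmetric]) (auto intro!: borel_measurable_Max cong: if_cong)
  also have "\<dots> = (\<integral>\<^sup>+x. (\<Sum>i<K. ennreal (p i) * ennreal (?h x i)) \<partial>D)"
    by (intro nn_integral_cong nn_integral_choose_arm p)
  also have "\<dots> \<le> (\<integral>\<^sup>+x. ennreal (exp (- (\<theta>\<^sup>2 * p k) / 4)) * ennreal (exp (p k * \<theta> * (x k - mean D k))) \<partial>D)"
  proof (intro nn_integral_mono)
    fix x assume "x \<in> space D"
    have "(\<Sum>i<K. ennreal (p i) * ennreal (?h x i)) = ennreal (\<Sum>i<K. p i * ?h x i)"
      using p(1) by (subst sum_ennreal[symmetric]) (simp_all add: ennreal_mult)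
    also have "(\<Sum>i<K. p i * ?h x i) = p k * ?h x k + (\<Sum>i\<in>{..<K} - {k}. p i * ?h x i)"
      using k by (subst sum.remove[of _ k]) auto
    \<comment> \<open>\<open>K\<close> is no arm, so \<open>?h x K\<close> is the common value for
      all draws other than \<open>k\<close>.\<close>
    also have "(\<Sum>i\<in>{..<K} - {k}. p i * ?h x i) = (\<Sum>i\<in>{..<K} - {k}. p i * ?h x K)"
      using k by (intro sum.cong) auto
    also have "\<dots> = (\<Sum>i\<in>{..<K} - {k}. p i) * ?h x K" by (rule sum_distrib_right[symmetric])
    also have "(\<Sum>i\<in>{..<K} - {k}. p i) = 1 - p k"
      using p(2) k by (simp add: sum_diff1)
    also have "p k * ?h x k + (1 - p k) * ?h x K
        \<le> exp (- (\<theta>\<^sup>2 * p k) / 4) * exp (p k * \<theta> * (x k - mean D k))"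
    proof -
      have "\<bar>y x k - x k\<bar> \<le> ?c x" using k by (intro Max_ge) auto
      from bernoulli_exp_le[OF pk _ _ this \<theta>, of "mean D k"] y(2)[OF k, of x] k
      show ?thesis by simp
    qed
    finally show "(\<Sum>i<K. ennreal (p i) * ennreal (?h x i))
        \<le> ennreal (exp (- (\<theta>\<^sup>2 * p k) / 4)) * ennreal (exp (p k * \<theta> * (x k - mean D k)))"
      by (simp add: ennreal_mult[symmetric] ennreal_leI)
  qed
  also have "\<dots> = ennreal (exp (- (\<theta>\<^sup>2 * p k) / 4)) * (\<integral>\<^sup>+x. ennreal (exp (p k * \<theta> * (x k - mean D k))) \<partial>D)"
    by (rule nn_integral_cmult) measurable
  also have "\<dots> \<le> ennreal (exp (- (\<theta>\<^sup>2 * p k) / 4)) * ennreal (exp ((p k * \<theta>)\<^sup>2 / 8))"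
  proof (rule mult_left_mono)
    have "AE x in D. 0 \<le> x k \<and> x k \<le> 1" using b k by (auto elim!: eventually_mono)
    thus "(\<integral>\<^sup>+x. ennreal (exp (p k * \<theta> * (x k - mean D k))) \<partial>D) \<le> ennreal (exp ((p k * \<theta>)\<^sup>2 / 8))"
      unfolding mean_def by (intro nn_integral_exp_centered_le D.prob_space_axioms) auto
  qed simp
  also have "\<dots> = ennreal (exp (- (\<theta>\<^sup>2 * p k) / 4 + (p k * \<theta>)\<^sup>2 / 8))"
    by (simp only: ennreal_mult[symmetric] exp_ge_zero exp_add)
  also have "\<dots> \<le> 1"
  proof -
    \<comment> \<open>The reward enters scaled by \<open>p k\<close>, so its variance proxy is of
      order \<open>(p k)^2\<close> and fits into the saved quarter of the penalty.\<close>
    have "(p k)\<^sup>2 \<le> p k" using pk by (simp add: power2_eq_square mult_left_le)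
    hence "\<theta>\<^sup>2 * (p k)\<^sup>2 \<le> \<theta>\<^sup>2 * p k" by (intro mult_left_mono) auto
    moreover have "0 \<le> \<theta>\<^sup>2 * p k" using pk by simp
    ultimately have "- (\<theta>\<^sup>2 * p k) / 4 + (p k * \<theta>)\<^sup>2 / 8 \<le> 0" by (simp add: power_mult_distrib mult.commute)
    thus ?thesis by simp
  qed
  finally show ?thesis .
qed

subsection \<open>The interaction of BARBAT with the adversary\<close>

text \<open>Allows the state after epoch \<open>m\<close> to be read off any longer history with the
  same beginning.\<close>

lemma barbat_state_cong:
  assumes "\<And>s. s < T_ep K m \<Longrightarrow> h ! s = h' ! s"
  shows "barbat_state K h m = barbat_state K h' m"
  using assms
proof (induction m)
  case (Suc m)
  have "barbat_state K h m = barbat_state K h' m"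
    by (rule Suc.IH) (use Suc.prems T_ep_mono[of m "Suc m" K] in auto)
  moreover have "epoch_sum K (Suc m) h k = epoch_sum K (Suc m) h' k" for k
    unfolding epoch_sum_def using Suc.prems by (intro sum.cong) auto
  ultimately show ?case by (simp add: Let_def)
qed simp

text \<open>Sums over an index set independent of the random leader, a form suited to measurability
  proofs.\<close>

lemma n_tilde_alt:
  "n_tilde K m Dl r k = (if k = leader K r
     then real (N_ep K m) - (\<Sum>j<K. if j = leader K r then 0 else n_base K m Dl j)
     else n_base K m Dl k)"
proof -
  have "(\<Sum>j\<in>{..<K} - {leader K r}. n_base K m Dl j)
      = (\<Sum>j<K. if j = leader K r then 0 else n_base K m Dl j)"
    by (rule sum.mono_neutral_cong_left) auto
  thus ?thesis by (simp add: n_tilde_def)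
qed

lemma measurable_leader [measurable]:
  assumes [measurable]: "\<And>k. (\<lambda>x. r x k) \<in> borel_measurable M"
  shows "(\<lambda>x. leader K (r x)) \<in> measurable M (count_space UNIV)"
  unfolding leader_def by measurable

lemma measurable_n_tilde [measurable]:
  assumes [measurable]: "\<And>k. (\<lambda>x. Dl x k) \<in> borel_measurable M" "\<And>k. (\<lambda>x. r x k) \<in> borel_measurable M"
  shows "(\<lambda>x. n_tilde K m (Dl x) (r x) k) \<in> borel_measurable M"
  unfolding n_tilde_alt n_base_def by measurable

lemma measurable_barbat_state:
  assumes "\<And>s. s < T_ep K m \<Longrightarrow> (\<lambda>x. fst (h x ! s)) \<in> measurable M (count_space UNIV)"
    and "\<And>s. s < T_ep K m \<Longrightarrow> (\<lambda>x. snd (h x ! s)) \<in> borel_measurable M"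
  shows "(\<lambda>x. fst (barbat_state K (h x) m) k) \<in> borel_measurable M
    \<and> (\<lambda>x. snd (barbat_state K (h x) m) k) \<in> borel_measurable M"
  using assms
proof (induction m arbitrary: k)
  case (Suc m)
  have IH: "(\<lambda>x. fst (barbat_state K (h x) m) k) \<in> borel_measurable M"
    "(\<lambda>x. snd (barbat_state K (h x) m) k) \<in> borel_measurable M" for k
    using Suc.IH[of k] Suc.prems T_ep_mono[of m "Suc m" K] by auto
  note IH[measurable]
  have [measurable]: "(\<lambda>x. epoch_sum K (Suc m) (h x) k) \<in> borel_measurable M" for k
    unfolding epoch_sum_def
  proof (intro borel_measurable_sum)
    fix s assume "s \<in> {T_ep K (Suc m - 1)..<T_ep K (Suc m)}"
    hence "s < T_ep K (Suc m)" by simp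
    note [measurable] = Suc.prems[OF this]
    show "(\<lambda>x. if fst (h x ! s) = k then snd (h x ! s) else 0) \<in> borel_measurable M"
      by measurable
  qed
  define r' where "r' = (\<lambda>x k. min (epoch_sum K (Suc m) (h x) k
    / n_tilde K (Suc m) (fst (barbat_state K (h x) m)) (snd (barbat_state K (h x) m)) k) 1)"
  have [measurable]: "(\<lambda>x. r' x k) \<in> borel_measurable M" for k
    unfolding r'_def by measurable
  define R where "R = (\<lambda>x. Max ((\<lambda>k. r' x k - sqrt (4 * ln (4 / beta_par K (Suc m))
    / n_tilde K (Suc m) (fst (barbat_state K (h x) m)) (snd (barbat_state K (h x) m)) k)) ` {..<K}))"
  have [measurable]: "R \<in> borel_measurable M"
    unfolding R_def by (intro borel_measurable_Max) measurable
  have "snd (barbat_state K (h x) (Suc m)) k = r' x k"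
    "fst (barbat_state K (h x) (Suc m)) k = max ((1 / 2) ^ Suc m) (R x - r' x k)" for x
    by (simp_all add: Let_def r'_def R_def)
  thus ?case by simp
qed simp

locale corrupted_bandit =
  fixes K :: nat and D :: "(nat \<Rightarrow> real) measure" and adv :: adversary
  assumes K: "2 \<le> K" and D: "valid_reward_dist K D" and adv: "valid_adversary K adv"
begin

abbreviation P where "P \<equiv> omega_space D"

definition hist :: "(nat \<Rightarrow> (nat \<Rightarrow> real) \<times> real) \<Rightarrow> nat \<Rightarrow> (nat \<times> real) list" where
  "hist \<omega> t = map (\<lambda>s. (arm K adv \<omega> s, corrupted K adv \<omega> s (arm K adv \<omega> s))) [0..<t]"

lemma hist_nth: "s < t \<Longrightarrow> hist \<omega> t ! s = (arm K adv \<omega> s, corrupted K adv \<omega> s (arm K adv \<omega> s))"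
  by (simp add: hist_def)

lemma length_arms_prefix: "length (arms_prefix K adv \<omega> t) = t"
  by (induction t) (simp_all add: Let_def)

lemma arms_prefix_Suc: "arms_prefix K adv \<omega> (Suc t) = arms_prefix K adv \<omega> t @ [arm K adv \<omega> t]"
  by (simp add: arm_def Let_def nth_append length_arms_prefix)

lemma arms_prefix_eq: "arms_prefix K adv \<omega> t = map (arm K adv \<omega>) [0..<t]"
  by (induction t) (simp_all add: arms_prefix_Suc del: arms_prefix.simps(2))

lemma adv_cong:
  assumes "\<And>s. s \<le> t \<Longrightarrow> r s = r' s" "\<And>s. s < t \<Longrightarrow> I s = I' s"
  shows "adv t r I = adv t r' I'"
  using adv assms unfolding valid_adversary_def by blast

lemma adv_bounds: "k < K \<Longrightarrow> 0 \<le> adv t r I k \<and> adv t r I k \<le> 1"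
  using adv unfolding valid_adversary_def by blast

lemma corrupted_bounds: "k < K \<Longrightarrow> 0 \<le> corrupted K adv \<omega> t k \<and> corrupted K adv \<omega> t k \<le> 1"
  unfolding corrupted_def by (rule adv_bounds)

text \<open>The recursion hands the adversary an arm list padded with 0 beyond the past. By
  causality the adversary does not see the padding, so the recorded rewards agree with
  \<open>corrupted\<close>.\<close>

lemma arm_eq: "arm K adv \<omega> t = choose_arm K (barbat_probs K (hist \<omega> t) t) (snd (\<omega> t))"
proof -
  define l where "l = arms_prefix K adv \<omega> t"
  define I where "I = (\<lambda>s. if s < length l then l ! s else 0)"
  have l: "l ! s = arm K adv \<omega> s" if "s < t" for s
    using that by (simp add: l_def arms_prefix_eq)
  have len: "length l = t" by (simp add: l_def length_arms_prefix)
  have "adv s (\<lambda>s'. fst (\<omega> s')) I = corrupted K adv \<omega> s" if "s < t" for s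
    unfolding corrupted_def by (rule adv_cong) (use that l len in \<open>auto simp: I_def\<close>)
  hence "map (\<lambda>s. (l ! s, adv s (\<lambda>s'. fst (\<omega> s')) I (l ! s))) [0..<t] = hist \<omega> t"
    unfolding hist_def using l by (intro map_cong) auto
  moreover have "arms_prefix K adv \<omega> (Suc t) = l @ [choose_arm K (barbat_probs K
      (map (\<lambda>s. (l ! s, adv s (\<lambda>s'. fst (\<omega> s')) I (l ! s))) [0..<t]) t) (snd (\<omega> t))]"
    unfolding I_def l_def by (simp add: Let_def)
  ultimately show ?thesis by (simp add: arm_def nth_append len)
qed

lemma arm_less: "arm K adv \<omega> t < K"
  unfolding arm_eq by (rule choose_arm_less) (use K in simp)

text \<open>Causality of the joint process; it ensures that resampling round \<open>t\<close> leaves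
  everything before \<open>t\<close> unchanged.\<close>

lemma arm_cong:
  assumes "\<And>s. s \<le> t \<Longrightarrow> \<omega> s = \<omega>' s" shows "arm K adv \<omega> t = arm K adv \<omega>' t"
  using assms
proof (induction t rule: less_induct)
  case (less t)
  have arm: "arm K adv \<omega> s = arm K adv \<omega>' s" if "s < t" for s
    by (rule less.IH[OF that]) (use less.prems that in auto)
  have "corrupted K adv \<omega> s = corrupted K adv \<omega>' s" if "s < t" for s
    unfolding corrupted_def by (rule adv_cong) (use less.prems that arm in auto)
  hence "hist \<omega> t = hist \<omega>' t" unfolding hist_def using arm by (intro map_cong) auto
  thus ?case unfolding arm_eq using less.prems[of t] by simp
qed

lemma corrupted_cong:
  assumes "\<And>s. s \<le> t \<Longrightarrow> \<omega> s = \<omega>' s" shows "corrupted K adv \<omega> t = corrupted K adv \<omega>' t"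
  unfolding corrupted_def by (rule adv_cong) (use assms in \<open>auto intro: arm_cong\<close>)

lemma hist_cong:
  assumes "\<And>s. s < t \<Longrightarrow> \<omega> s = \<omega>' s" shows "hist \<omega> t = hist \<omega>' t"
proof -
  have "arm K adv \<omega> s = arm K adv \<omega>' s" "corrupted K adv \<omega> s = corrupted K adv \<omega>' s" if "s < t" for s
    using assms that by (auto intro: arm_cong corrupted_cong)
  thus ?thesis unfolding hist_def by (intro map_cong) auto
qed

text \<open>Read off the history ending with epoch \<open>m\<close>, so the value is fixed for all
  rounds of epoch \<open>Suc m\<close>.\<close>

definition Dl :: "(nat \<Rightarrow> (nat \<Rightarrow> real) \<times> real) \<Rightarrow> nat \<Rightarrow> nat \<Rightarrow> real" where
  "Dl \<omega> m = fst (barbat_state K (hist \<omega> (T_ep K m)) m)"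

definition r :: "(nat \<Rightarrow> (nat \<Rightarrow> real) \<times> real) \<Rightarrow> nat \<Rightarrow> nat \<Rightarrow> real" where
  "r \<omega> m = snd (barbat_state K (hist \<omega> (T_ep K m)) m)"

definition nt :: "(nat \<Rightarrow> (nat \<Rightarrow> real) \<times> real) \<Rightarrow> nat \<Rightarrow> nat \<Rightarrow> real" where
  "nt \<omega> m = n_tilde K (Suc m) (Dl \<omega> m) (r \<omega> m)"

definition Z :: "nat \<Rightarrow> (nat \<Rightarrow> (nat \<Rightarrow> real) \<times> real) \<Rightarrow> nat \<Rightarrow> real" where
  "Z k \<omega> s = (if arm K adv \<omega> s = k then corrupted K adv \<omega> s k else 0)"

definition cmax :: "(nat \<Rightarrow> (nat \<Rightarrow> real) \<times> real) \<Rightarrow> nat \<Rightarrow> real" where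
  "cmax \<omega> t = Max ((\<lambda>k. \<bar>corrupted K adv \<omega> t k - fst (\<omega> t) k\<bar>) ` {..<K})"

definition epoch_corr :: "(nat \<Rightarrow> (nat \<Rightarrow> real) \<times> real) \<Rightarrow> nat \<Rightarrow> real" where
  "epoch_corr \<omega> m = (\<Sum>s\<in>{T_ep K m..<T_ep K (Suc m)}. cmax \<omega> s)"

text \<open>Index \<open>m\<close> stands for the bad event of epoch \<open>Suc m\<close>, matching
  \<open>epoch_corr\<close> and \<open>nt\<close>.\<close>

definition fail :: "nat \<Rightarrow> (nat \<Rightarrow> (nat \<Rightarrow> real) \<times> real) \<Rightarrow> bool" where
  "fail m \<omega> \<longleftrightarrow> (\<exists>k<K. sqrt (4 * conf K (Suc m) / nt \<omega> m k) + epoch_corr \<omega> m / real (N_ep K (Suc m))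
     < \<bar>r \<omega> (Suc m) k - mean D k\<bar>)"

text \<open>The value 1 is a valid error on failure because estimates and means both lie in
  \<open>[0, 1]\<close>. Index 0 is a default, as epochs start at 1.\<close>

definition err :: "(nat \<Rightarrow> (nat \<Rightarrow> real) \<times> real) \<Rightarrow> nat \<Rightarrow> real" where
  "err \<omega> m = (case m of 0 \<Rightarrow> 0
     | Suc j \<Rightarrow> if fail j \<omega> then 1 else epoch_corr \<omega> j / real (N_ep K (Suc j)))"

lemma state_eq:
  assumes "T_ep K m \<le> t"
  shows "barbat_state K (hist \<omega> t) m = (Dl \<omega> m, r \<omega> m)"
proof -
  have "barbat_state K (hist \<omega> t) m = barbat_state K (hist \<omega> (T_ep K m)) m"
    by (rule barbat_state_cong) (use assms in \<open>simp add: hist_nth\<close>)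
  thus ?thesis by (simp add: Dl_def r_def)
qed

lemma barbat_probs_eq:
  assumes "T_ep K m \<le> t" "t < T_ep K (Suc m)"
  shows "barbat_probs K (hist \<omega> t) t = (\<lambda>k. nt \<omega> m k / real (N_ep K (Suc m)))"
  using assms by (simp add: barbat_probs_def epoch_of_eq state_eq probs_def nt_def fun_eq_iff)

lemma Dl_0: "Dl \<omega> 0 k = 1" and r_0: "r \<omega> 0 k = 0"
  by (simp_all add: Dl_def r_def)

lemma epoch_sum_eq:
  "epoch_sum K (Suc m) (hist \<omega> (T_ep K (Suc m))) k = (\<Sum>s\<in>{T_ep K m..<T_ep K (Suc m)}. Z k \<omega> s)"
  unfolding epoch_sum_def by (intro sum.cong) (auto simp: hist_nth Z_def)

lemma r_Suc: "r \<omega> (Suc m) k = min ((\<Sum>s\<in>{T_ep K m..<T_ep K (Suc m)}. Z k \<omega> s) / nt \<omega> m k) 1"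
  and Dl_Suc: "Dl \<omega> (Suc m) k = max ((1 / 2) ^ Suc m)
      (Max ((\<lambda>k. r \<omega> (Suc m) k - sqrt (4 * conf K (Suc m) / nt \<omega> m k)) ` {..<K}) - r \<omega> (Suc m) k)"
proof -
  have *: "barbat_state K (hist \<omega> (T_ep K (Suc m))) m = (Dl \<omega> m, r \<omega> m)"
    by (rule state_eq) (simp add: T_ep_mono)
  show r: "r \<omega> (Suc m) k = min ((\<Sum>s\<in>{T_ep K m..<T_ep K (Suc m)}. Z k \<omega> s) / nt \<omega> m k) 1" for k
    unfolding r_def[of \<omega> "Suc m"] by (simp add: * Let_def epoch_sum_eq nt_def)
  show "Dl \<omega> (Suc m) k = max ((1 / 2) ^ Suc m)
      (Max ((\<lambda>k. r \<omega> (Suc m) k - sqrt (4 * conf K (Suc m) / nt \<omega> m k)) ` {..<K}) - r \<omega> (Suc m) k)"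
    unfolding Dl_def[of \<omega> "Suc m"] r by (simp add: * Let_def epoch_sum_eq nt_def conf_def)
qed

lemma cmax_nonneg: "0 \<le> cmax \<omega> t"
proof -
  have "\<bar>corrupted K adv \<omega> t 0 - fst (\<omega> t) 0\<bar> \<le> cmax \<omega> t"
    unfolding cmax_def using K by (intro Max_ge) auto
  thus ?thesis by linarith
qed

lemma epoch_corr_nonneg: "0 \<le> epoch_corr \<omega> m"
  unfolding epoch_corr_def by (intro sum_nonneg cmax_nonneg)

lemma mean_bounds: assumes "k < K" shows "0 \<le> mean D k \<and> mean D k \<le> 1"
proof -
  interpret D: prob_space D using D by (simp add: valid_reward_dist_def)
  have sD: "sets D = sets vec_space" and b: "AE x in D. \<forall>k<K. 0 \<le> x k \<and> x k \<le> 1"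
    using D by (auto simp: valid_reward_dist_def)
  have m: "(\<lambda>x. x k) \<in> borel_measurable D"
    using measurable_component_vec by (simp add: measurable_cong_sets[OF sD refl])
  have b': "AE x in D. 0 \<le> x k" "AE x in D. x k \<le> 1" using b assms by (auto elim!: eventually_mono)
  have "integrable D (\<lambda>x. x k)"
  proof (rule D.integrable_const_bound[OF _ m])
    show "AE x in D. norm (x k) \<le> 1" using b' by eventually_elim simp
  qed
  hence "(\<integral>x. x k \<partial>D) \<le> 1" using b'(2) by (rule D.integral_le_const)
  moreover have "0 \<le> (\<integral>x. x k \<partial>D)" using b'(1) by (rule integral_nonneg_AE)
  ultimately show ?thesis by (simp add: mean_def)
qed

sublocale core: barbat_core K "Dl \<omega>" "r \<omega>" for \<omega>
proof
  show "2 \<le> K" by (rule K)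
  show "(1 / 2) ^ m \<le> Dl \<omega> m k" for m k
    by (cases m) (simp_all add: Dl_0 Dl_Suc)
qed

lemma nt_pos: "0 < nt \<omega> m k"
  unfolding nt_def by (rule core.n_tilde_pos)

lemma r_bounds: "k < K \<Longrightarrow> 0 \<le> r \<omega> m k \<and> r \<omega> m k \<le> 1"
proof (cases m)
  case (Suc j)
  assume "k < K"
  hence "0 \<le> (\<Sum>s\<in>{T_ep K j..<T_ep K (Suc j)}. Z k \<omega> s)"
    by (intro sum_nonneg) (auto simp: Z_def corrupted_bounds)
  thus ?thesis using nt_pos[of \<omega> j k] by (simp add: Suc r_Suc)
qed (simp add: r_0)

sublocale run: barbat_run K "Dl \<omega>" "r \<omega>" "mean D" "err \<omega>" for \<omega>
proof
  fix m k
  show "Dl \<omega> (Suc m) k = max ((1 / 2) ^ Suc m)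
      (Max ((\<lambda>k. r \<omega> (Suc m) k - sqrt (4 * conf K (Suc m) / n_tilde K (Suc m) (Dl \<omega> m) (r \<omega> m) k)) ` {..<K})
        - r \<omega> (Suc m) k)"
    by (rule Dl_Suc[unfolded nt_def])
  show "0 \<le> err \<omega> m"
    by (cases m) (simp_all add: err_def epoch_corr_nonneg)
  assume k: "k < K"
  show "0 \<le> mean D k \<and> mean D k \<le> 1" "0 \<le> r \<omega> m k \<and> r \<omega> m k \<le> 1"
    using mean_bounds r_bounds k by auto
  have "0 \<le> sqrt (4 * conf K (Suc m) / nt \<omega> m k)"
    using nt_pos[of \<omega> m k] conf_ge_1[OF K, of "Suc m"] by simp
  hence "\<bar>r \<omega> (Suc m) k - mean D k\<bar> \<le> sqrt (4 * conf K (Suc m) / nt \<omega> m k) + err \<omega> (Suc m)"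
  proof (cases "fail m \<omega>")
    case True
    have "\<bar>r \<omega> (Suc m) k - mean D k\<bar> \<le> 1"
      using mean_bounds[OF k] r_bounds[OF k, of \<omega> "Suc m"] by linarith
    moreover have "err \<omega> (Suc m) = 1" using True by (simp add: err_def)
    ultimately show ?thesis using \<open>0 \<le> sqrt _\<close> by linarith
  next
    case False
    hence "\<not> sqrt (4 * conf K (Suc m) / nt \<omega> m k) + epoch_corr \<omega> m / real (N_ep K (Suc m))
      < \<bar>r \<omega> (Suc m) k - mean D k\<bar>" using k unfolding fail_def by blast
    thus ?thesis using False by (simp add: err_def)
  qed
  thus "\<bar>r \<omega> (Suc m) k - mean D k\<bar>
      \<le> sqrt (4 * conf K (Suc m) / n_tilde K (Suc m) (Dl \<omega> m) (r \<omega> m) k) + err \<omega> (Suc m)"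
    unfolding nt_def .
qed (rule Dl_0)

subsection \<open>Measurability and concentration\<close>

lemma prob_space_D: "prob_space D"
  using D by (simp add: valid_reward_dist_def)

lemma prob_space_round: "prob_space (D \<Otimes>\<^sub>M unif)"
  by (intro prob_space_pair prob_space_D prob_space_unif)

sublocale P: prob_space P
  unfolding omega_space_def by (rule prob_space_PiM) (rule prob_space_round)

lemma measurable_D: "measurable M D = measurable M vec_space" "measurable D N = measurable vec_space N"
  using D by (auto simp: valid_reward_dist_def intro!: measurable_cong_sets)

lemma measurable_reward: "(\<lambda>\<omega>. fst (\<omega> s)) \<in> measurable P vec_space"
proof -
  have "(\<lambda>\<omega>. \<omega> s) \<in> measurable P (D \<Otimes>\<^sub>M unif)"
    unfolding omega_space_def by (rule measurable_component_singleton) simp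
  from measurable_compose[OF this measurable_fst] show ?thesis by (simp add: measurable_D)
qed

lemma measurable_seed: "(\<lambda>\<omega>. snd (\<omega> s)) \<in> borel_measurable P"
proof -
  have "(\<lambda>\<omega>. \<omega> s) \<in> measurable P (D \<Otimes>\<^sub>M unif)"
    unfolding omega_space_def by (rule measurable_component_singleton) simp
  from measurable_compose[OF this measurable_snd] show ?thesis
    by (simp add: measurable_cong_sets[OF refl sets_uniform_measure])
qed

lemma measurable_reward_coord: "(\<lambda>\<omega>. fst (\<omega> s) k) \<in> borel_measurable P"
  by (rule measurable_compose[OF measurable_reward measurable_component_vec])

lemma measurable_adv:
  assumes "\<And>s. (\<lambda>x. R x s) \<in> measurable M vec_space"
    and "\<And>s. (\<lambda>x. I x s) \<in> measurable M (count_space UNIV)"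
  shows "(\<lambda>x. adv t (R x) (I x)) \<in> measurable M vec_space"
proof -
  have sp: "space vec_space = UNIV" by (simp add: vec_space_def space_PiM)
  have R: "(\<lambda>x. R x) \<in> measurable M (PiM UNIV (\<lambda>_::nat. vec_space))"
    using measurable_PiM_single'[of UNIV "\<lambda>s x. R x s" M "\<lambda>_. vec_space"] assms(1) by (simp add: sp)
  have I: "(\<lambda>x. I x) \<in> measurable M (PiM UNIV (\<lambda>_::nat. count_space (UNIV :: nat set)))"
    using measurable_PiM_single'[of UNIV "\<lambda>s x. I x s" M "\<lambda>_. count_space UNIV"] assms(2) by simp
  have "(\<lambda>(r, I). adv t r I) \<in> measurable
      (PiM UNIV (\<lambda>_::nat. vec_space) \<Otimes>\<^sub>M PiM UNIV (\<lambda>_::nat. count_space (UNIV :: nat set))) vec_space"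
    using adv by (auto simp: valid_adversary_def)
  from measurable_compose[OF measurable_Pair[OF R I] this] show ?thesis by simp
qed

text \<open>Cutting off the arms at round \<open>t\<close> means that only earlier arms need to be
  measurable, which avoids circularity in the induction for \<open>measurable_arm\<close>.\<close>

lemma measurable_corrupted_aux:
  assumes "\<And>s. s < t \<Longrightarrow> (\<lambda>\<omega>. arm K adv \<omega> s) \<in> measurable P (count_space UNIV)"
  shows "(\<lambda>\<omega>. corrupted K adv \<omega> t k) \<in> borel_measurable P"
proof -
  have "corrupted K adv \<omega> t = adv t (\<lambda>s. fst (\<omega> s)) (\<lambda>s. if s < t then arm K adv \<omega> s else 0)" for \<omega>
    unfolding corrupted_def by (rule adv_cong) auto
  moreover have "(\<lambda>\<omega>. adv t (\<lambda>s. fst (\<omega> s)) (\<lambda>s. if s < t then arm K adv \<omega> s else 0))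
      \<in> measurable P vec_space"
  proof (rule measurable_adv)
    fix s
    show "(\<lambda>\<omega>. if s < t then arm K adv \<omega> s else 0) \<in> measurable P (count_space UNIV)"
      using assms[of s] by (cases "s < t") auto
  qed (rule measurable_reward)
  ultimately show ?thesis using measurable_compose[OF _ measurable_component_vec] by simp
qed

lemma measurable_state_aux:
  assumes arm: "\<And>s. s < T_ep K m \<Longrightarrow> (\<lambda>\<omega>. arm K adv \<omega> s) \<in> measurable P (count_space UNIV)"
  shows "(\<lambda>\<omega>. Dl \<omega> m k) \<in> borel_measurable P" "(\<lambda>\<omega>. r \<omega> m k) \<in> borel_measurable P"
proof -
  have "(\<lambda>\<omega>. corrupted K adv \<omega> s (arm K adv \<omega> s)) \<in> borel_measurable P" if "s < T_ep K m" for s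
    by (rule measurable_compose_countable[OF measurable_corrupted_aux]) (use arm that in auto)
  hence "(\<lambda>\<omega>. fst (barbat_state K (hist \<omega> (T_ep K m)) m) k) \<in> borel_measurable P
    \<and> (\<lambda>\<omega>. snd (barbat_state K (hist \<omega> (T_ep K m)) m) k) \<in> borel_measurable P"
    by (intro measurable_barbat_state) (use arm in \<open>auto simp: hist_nth\<close>)
  thus "(\<lambda>\<omega>. Dl \<omega> m k) \<in> borel_measurable P" "(\<lambda>\<omega>. r \<omega> m k) \<in> borel_measurable P"
    by (auto simp: Dl_def r_def)
qed

text \<open>By strong induction on rounds: the sampling distribution in an epoch depends only on
  arms drawn before that epoch, and the seed is fresh.\<close>

lemma measurable_arm [measurable]: "(\<lambda>\<omega>. arm K adv \<omega> t) \<in> measurable P (count_space UNIV)"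
proof (induction t rule: less_induct)
  case (less t)
  obtain m where m: "T_ep K m \<le> t" "t < T_ep K (Suc m)" by (rule ex_epoch[OF K])
  have [measurable]: "(\<lambda>\<omega>. Dl \<omega> m k) \<in> borel_measurable P" "(\<lambda>\<omega>. r \<omega> m k) \<in> borel_measurable P" for k
    using m(1) less.IH by (auto intro!: measurable_state_aux)
  note [measurable] = measurable_seed
  show ?case unfolding arm_eq barbat_probs_eq[OF m] nt_def by measurable
qed

lemma measurable_corrupted [measurable]: "(\<lambda>\<omega>. corrupted K adv \<omega> t k) \<in> borel_measurable P"
  by (rule measurable_corrupted_aux) measurable

lemma measurable_Dl [measurable]: "(\<lambda>\<omega>. Dl \<omega> m k) \<in> borel_measurable P"
  and measurable_r [measurable]: "(\<lambda>\<omega>. r \<omega> m k) \<in> borel_measurable P"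
  by (rule measurable_state_aux; measurable)+

lemma measurable_nt [measurable]: "(\<lambda>\<omega>. nt \<omega> m k) \<in> borel_measurable P"
  unfolding nt_def by measurable

lemma measurable_cmax [measurable]: "(\<lambda>\<omega>. cmax \<omega> t) \<in> borel_measurable P"
  unfolding cmax_def using measurable_reward_coord
  by (intro borel_measurable_Max) auto

lemma measurable_Z [measurable]: "(\<lambda>\<omega>. Z k \<omega> t) \<in> borel_measurable P"
  unfolding Z_def by measurable

lemma measurable_epoch_corr [measurable]: "(\<lambda>\<omega>. epoch_corr \<omega> m) \<in> borel_measurable P"
  unfolding epoch_corr_def by measurable

lemma measurable_fail [measurable]: "Measurable.pred P (fail m)"
  unfolding fail_def by measurable

section \<open>Conditioning on the past by resampling one round\<close>

definition pr :: "(nat \<Rightarrow> (nat \<Rightarrow> real) \<times> real) \<Rightarrow> nat \<Rightarrow> nat \<Rightarrow> real" where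
  "pr \<omega> m k = nt \<omega> m k / real (N_ep K (Suc m))"

lemma pr_nonneg: "0 \<le> pr \<omega> m k"
  using nt_pos[of \<omega> m k] by (simp add: pr_def)

lemma sum_pr: "(\<Sum>k<K. pr \<omega> m k) = 1"
  using core.sum_n_tilde[of m \<omega>] N_ep_pos[OF K, of m]
  by (simp add: pr_def nt_def sum_divide_distrib[symmetric])

lemma nt_cong:
  assumes "\<And>s. s < T_ep K m \<Longrightarrow> \<omega> s = \<omega>' s" shows "nt \<omega> m = nt \<omega>' m"
  using hist_cong[of "T_ep K m" \<omega> \<omega>'] assms by (simp add: nt_def Dl_def r_def)

lemma hist_upd: "hist (fun_upd \<omega> t x) t = hist \<omega> t"
  by (rule hist_cong) simp

lemma nt_upd: "T_ep K m \<le> t \<Longrightarrow> nt (fun_upd \<omega> t x) m = nt \<omega> m"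
  by (rule nt_cong) simp

lemma arm_upd:
  assumes "T_ep K m \<le> t" "t < T_ep K (Suc m)"
  shows "arm K adv (fun_upd \<omega> t x) t = choose_arm K (pr \<omega> m) (snd x)"
  unfolding arm_eq hist_upd barbat_probs_eq[OF assms] pr_def[symmetric] by simp

text \<open>The arms on the right are those of the original outcome: the adversary reads only arms
  before \<open>t\<close>, which the update does not affect.\<close>

lemma corrupted_upd:
  "corrupted K adv (fun_upd \<omega> t x) t = adv t (\<lambda>s. if s = t then fst x else fst (\<omega> s)) (arm K adv \<omega>)"
  unfolding corrupted_def by (rule adv_cong) (auto intro: arm_cong)

lemma resample:
  "f \<in> borel_measurable P \<Longrightarrow> (\<integral>\<^sup>+\<omega>. f \<omega> \<partial>P) = (\<integral>\<^sup>+\<omega>. (\<integral>\<^sup>+x. f (fun_upd \<omega> t x) \<partial>(D \<Otimes>\<^sub>M unif)) \<partial>P)"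
  unfolding omega_space_def by (rule nn_integral_PiM_resample[OF prob_space_round])

lemma nn_integral_choose_arm_round:
  fixes f :: "nat \<Rightarrow> ennreal"
  assumes "\<And>j. j < K \<Longrightarrow> 0 \<le> p j" "(\<Sum>j<K. p j) = 1"
  shows "(\<integral>\<^sup>+x. f (choose_arm K p (snd x)) \<partial>(D \<Otimes>\<^sub>M unif)) = (\<Sum>k<K. ennreal (p k) * f k)"
proof -
  interpret D: prob_space D by (rule prob_space_D)
  interpret U: prob_space unif by (rule prob_space_unif)
  have "(\<integral>\<^sup>+x. f (choose_arm K p (snd x)) \<partial>(D \<Otimes>\<^sub>M unif))
      = (\<integral>\<^sup>+x. (\<integral>\<^sup>+u. f (choose_arm K p u) \<partial>unif) \<partial>D)"
    by (subst U.nn_integral_fst[symmetric]) auto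
  also have "\<dots> = (\<Sum>k<K. ennreal (p k) * f k)"
    using nn_integral_choose_arm[OF assms, of f] by (simp add: D.emeasure_space_1)
  finally show ?thesis .
qed

lemma gap_bounds: "k < K \<Longrightarrow> 0 \<le> gap K D k \<and> gap K D k \<le> 1"
  using run.g_bounds[of k] by (simp add: run.g_def run.best_def gap_def)

text \<open>Given the past, the arm of round \<open>t\<close> has law \<open>pr \<omega> m\<close>;
  resampling round \<open>t\<close> averages the gap over that law.\<close>

lemma expected_gap:
  assumes t: "T_ep K m \<le> t" "t < T_ep K (Suc m)"
  shows "(\<integral>\<omega>. gap K D (arm K adv \<omega> t) \<partial>P) = (\<integral>\<omega>. (\<Sum>k<K. pr \<omega> m k * gap K D k) \<partial>P)"
proof -
  have [measurable]: "(\<lambda>\<omega>. pr \<omega> m k) \<in> borel_measurable P" for k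
    unfolding pr_def by measurable
  have [measurable]: "(\<lambda>\<omega>. gap K D (arm K adv \<omega> t)) \<in> borel_measurable P"
    by (rule measurable_compose[OF measurable_arm]) simp
  have "(\<integral>\<^sup>+\<omega>. ennreal (gap K D (arm K adv \<omega> t)) \<partial>P)
      = (\<integral>\<^sup>+\<omega>. (\<integral>\<^sup>+x. ennreal (gap K D (choose_arm K (pr \<omega> m) (snd x))) \<partial>(D \<Otimes>\<^sub>M unif)) \<partial>P)"
    by (subst resample[of _ t]) (auto simp: arm_upd[OF t])
  also have "\<dots> = (\<integral>\<^sup>+\<omega>. (\<Sum>k<K. ennreal (pr \<omega> m k) * ennreal (gap K D k)) \<partial>P)"
    using nn_integral_choose_arm_round[OF pr_nonneg sum_pr, of "\<lambda>k. ennreal (gap K D k)"]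
    by (intro nn_integral_cong) auto
  also have "\<dots> = (\<integral>\<^sup>+\<omega>. ennreal (\<Sum>k<K. pr \<omega> m k * gap K D k) \<partial>P)"
  proof (intro nn_integral_cong)
    fix \<omega>
    show "(\<Sum>k<K. ennreal (pr \<omega> m k) * ennreal (gap K D k)) = ennreal (\<Sum>k<K. pr \<omega> m k * gap K D k)"
      using gap_bounds pr_nonneg by (subst sum_ennreal[symmetric]) (auto simp: ennreal_mult)
  qed
  finally show ?thesis
    using gap_bounds arm_less pr_nonneg
    by (subst (1 2) integral_eq_nn_integral) (auto intro!: sum_nonneg AE_I2)
qed

text \<open>The exponent is scaled by the sign \<open>\<sigma>\<close> so that both tails are covered; both the
  sampling probability and the scale are fixed when the epoch starts.\<close>

definition tilt :: "real \<Rightarrow> nat \<Rightarrow> nat \<Rightarrow> (nat \<Rightarrow> (nat \<Rightarrow> real) \<times> real) \<Rightarrow> real" where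
  "tilt \<sigma> m k \<omega> = \<sigma> * sqrt (conf K (Suc m) / nt \<omega> m k)"

definition step :: "real \<Rightarrow> nat \<Rightarrow> nat \<Rightarrow> (nat \<Rightarrow> (nat \<Rightarrow> real) \<times> real) \<Rightarrow> nat \<Rightarrow> real" where
  "step \<sigma> m k \<omega> s = tilt \<sigma> m k \<omega> * (Z k \<omega> s - pr \<omega> m k * mean D k)
    - \<bar>tilt \<sigma> m k \<omega>\<bar> * pr \<omega> m k * cmax \<omega> s - (tilt \<sigma> m k \<omega>)\<^sup>2 * pr \<omega> m k"

lemma measurable_step [measurable]: "(\<lambda>\<omega>. step \<sigma> m k \<omega> s) \<in> borel_measurable P"
  unfolding step_def tilt_def pr_def by measurable

text \<open>With this scale the quadratic penalties of a whole epoch add up to exactly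
  \<open>conf\<close>.\<close>

lemma tilt_sq: "\<bar>\<sigma>\<bar> = 1 \<Longrightarrow> (tilt \<sigma> m k \<omega>)\<^sup>2 * nt \<omega> m k = conf K (Suc m)"
  using nt_pos[of \<omega> m k] conf_ge_1[OF K, of "Suc m"] power2_abs[of \<sigma>]
  by (simp add: tilt_def power_mult_distrib)

lemma tilt_le: assumes "k < K" "\<bar>\<sigma>\<bar> = 1" shows "\<bar>tilt \<sigma> m k \<omega>\<bar> \<le> 1 / 4"
proof -
  have "lambda_par K (Suc m) \<le> nt \<omega> m k"
    using run.n_base_ge[OF assms(1), of m \<omega>] core.n_tilde_ge[of m \<omega> k] by (simp add: nt_def)
  hence n: "256 * conf K (Suc m) \<le> nt \<omega> m k" by (simp add: lambda_eq_conf[OF K])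
  hence "conf K (Suc m) / nt \<omega> m k \<le> (1 / 4)\<^sup>2"
    using nt_pos[of \<omega> m k] conf_ge_1[OF K, of "Suc m"] by (simp add: field_simps power2_eq_square)
  hence "sqrt (conf K (Suc m) / nt \<omega> m k) \<le> 1 / 4" by (rule real_le_lsqrt[rotated 1]) auto
  thus ?thesis using assms(2) nt_pos[of \<omega> m k] conf_ge_1[OF K, of "Suc m"]
    by (simp add: tilt_def abs_mult)
qed

lemma step_cong:
  assumes "T_ep K m \<le> s" "\<And>i. i \<le> s \<Longrightarrow> \<omega> i = \<omega>' i"
  shows "step \<sigma> m k \<omega> s = step \<sigma> m k \<omega>' s"
proof -
  have "nt \<omega> m = nt \<omega>' m" by (rule nt_cong) (use assms in auto)
  moreover have "arm K adv \<omega> s = arm K adv \<omega>' s" "corrupted K adv \<omega> s = corrupted K adv \<omega>' s"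
    using assms by (auto intro: arm_cong corrupted_cong)
  ultimately show ?thesis
    using assms(2)[of s] by (simp add: step_def tilt_def pr_def Z_def cmax_def)
qed

text \<open>With all rounds except \<open>t\<close> frozen, \<open>tilt\<close> and
  \<open>pr\<close> are constants and the corrupted vector is a function of the reward vector of
  round \<open>t\<close>, so \<open>one_round_exp_le\<close> applies.\<close>

lemma step_integral_le:
  assumes t: "T_ep K m \<le> t" "t < T_ep K (Suc m)" and k: "k < K" and \<sigma>: "\<bar>\<sigma>\<bar> = 1"
  shows "(\<integral>\<^sup>+x. ennreal (exp (step \<sigma> m k (fun_upd \<omega> t x) t)) \<partial>(D \<Otimes>\<^sub>M unif)) \<le> 1"
proof -
  define y where "y v = adv t (\<lambda>s. if s = t then v else fst (\<omega> s)) (arm K adv \<omega>)" for v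
  have sp: "space vec_space = UNIV" by (simp add: vec_space_def space_PiM)
  have y: "y \<in> measurable vec_space vec_space"
    unfolding y_def
  proof (rule measurable_adv)
    fix s show "(\<lambda>x. if s = t then x else fst (\<omega> s)) \<in> measurable vec_space vec_space"
      by (cases "s = t") (auto simp: sp)
  qed simp
  have tilt: "tilt \<sigma> m k (fun_upd \<omega> t x) = tilt \<sigma> m k \<omega>" "pr (fun_upd \<omega> t x) m = pr \<omega> m" for x
    using nt_upd[OF t(1), of \<omega> x] by (simp_all add: tilt_def pr_def fun_eq_iff)
  have "step \<sigma> m k (fun_upd \<omega> t x) t
      = tilt \<sigma> m k \<omega> * ((if choose_arm K (pr \<omega> m) (snd x) = k then y (fst x) k else 0) - pr \<omega> m k * mean D k)
      - \<bar>tilt \<sigma> m k \<omega>\<bar> * pr \<omega> m k * Max ((\<lambda>j. \<bar>y (fst x) j - fst x j\<bar>) ` {..<K})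
      - (tilt \<sigma> m k \<omega>)\<^sup>2 * pr \<omega> m k" for x
    unfolding step_def tilt Z_def cmax_def arm_upd[OF t] corrupted_upd y_def[symmetric] by simp
  thus ?thesis
    using one_round_exp_le[OF D pr_nonneg sum_pr k y _ tilt_le[OF k \<sigma>]] adv_bounds
    by (simp add: y_def)
qed

text \<open>Induction on the rounds of the epoch: resampling the newest round leaves the exponent of
  the earlier ones unchanged, so it factors out and the new factor integrates to at most 1.\<close>

lemma exp_supermartingale:
  assumes k: "k < K" and \<sigma>: "\<bar>\<sigma>\<bar> = 1" and n: "n \<le> N_ep K (Suc m)"
  shows "(\<integral>\<^sup>+\<omega>. ennreal (exp (\<Sum>s\<in>{T_ep K m..<T_ep K m + n}. step \<sigma> m k \<omega> s)) \<partial>P) \<le> 1"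
  using n
proof (induction n)
  case 0
  thus ?case by (simp add: P.emeasure_space_1)
next
  case (Suc n)
  let ?t = "T_ep K m + n"
  let ?W = "\<lambda>\<omega>. \<Sum>s\<in>{T_ep K m..<?t}. step \<sigma> m k \<omega> s"
  have t: "T_ep K m \<le> ?t" "?t < T_ep K (Suc m)" using Suc.prems by (auto simp: T_ep_Suc)
  have W: "?W (fun_upd \<omega> ?t x) = ?W \<omega>" for \<omega> x
    by (intro sum.cong refl step_cong) auto
  have "(\<integral>\<^sup>+\<omega>. ennreal (exp (\<Sum>s\<in>{T_ep K m..<T_ep K m + Suc n}. step \<sigma> m k \<omega> s)) \<partial>P)
      = (\<integral>\<^sup>+\<omega>. ennreal (exp (?W \<omega>)) * ennreal (exp (step \<sigma> m k \<omega> ?t)) \<partial>P)"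
    by (simp add: exp_add ennreal_mult)
  also have "\<dots> = (\<integral>\<^sup>+\<omega>. (\<integral>\<^sup>+x. ennreal (exp (?W \<omega>)) * ennreal (exp (step \<sigma> m k (fun_upd \<omega> ?t x) ?t))
      \<partial>(D \<Otimes>\<^sub>M unif)) \<partial>P)"
    by (subst resample[of _ ?t]) (measurable, simp only: W)
  also have "\<dots> \<le> (\<integral>\<^sup>+\<omega>. ennreal (exp (?W \<omega>)) \<partial>P)"
  proof (intro nn_integral_mono)
    fix \<omega> assume \<omega>: "\<omega> \<in> space P"
    have "(\<lambda>x. fun_upd \<omega> ?t x) \<in> measurable (D \<Otimes>\<^sub>M unif) P"
      unfolding omega_space_def
      by (rule measurable_fun_upd[of UNIV UNIV]) (use \<omega> in \<open>auto simp: omega_space_def\<close>)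
    hence "(\<lambda>x. step \<sigma> m k (fun_upd \<omega> ?t x) ?t) \<in> borel_measurable (D \<Otimes>\<^sub>M unif)"
      by (rule measurable_compose) measurable
    hence "(\<lambda>x. ennreal (exp (step \<sigma> m k (fun_upd \<omega> ?t x) ?t))) \<in> borel_measurable (D \<Otimes>\<^sub>M unif)"
      by (rule measurable_compose[where g = "\<lambda>v. ennreal (exp v)"]) measurable
    hence "(\<integral>\<^sup>+x. ennreal (exp (?W \<omega>)) * ennreal (exp (step \<sigma> m k (fun_upd \<omega> ?t x) ?t)) \<partial>(D \<Otimes>\<^sub>M unif))
        = ennreal (exp (?W \<omega>)) * (\<integral>\<^sup>+x. ennreal (exp (step \<sigma> m k (fun_upd \<omega> ?t x) ?t)) \<partial>(D \<Otimes>\<^sub>M unif))"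
      by (rule nn_integral_cmult)
    also have "\<dots> \<le> ennreal (exp (?W \<omega>)) * 1"
      by (intro mult_left_mono step_integral_le[OF t k \<sigma>]) simp
    finally show "(\<integral>\<^sup>+x. ennreal (exp (?W \<omega>)) * ennreal (exp (step \<sigma> m k (fun_upd \<omega> ?t x) ?t)) \<partial>(D \<Otimes>\<^sub>M unif))
        \<le> ennreal (exp (?W \<omega>))" by simp
  qed
  also have "\<dots> \<le> 1" using Suc by simp
  finally show ?case .
qed

section \<open>Failure probability of an epoch\<close>

definition W :: "real \<Rightarrow> nat \<Rightarrow> nat \<Rightarrow> (nat \<Rightarrow> (nat \<Rightarrow> real) \<times> real) \<Rightarrow> real" where
  "W \<sigma> m k \<omega> = (\<Sum>s\<in>{T_ep K m..<T_ep K (Suc m)}. step \<sigma> m k \<omega> s)"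

lemma W_eq:
  assumes "\<bar>\<sigma>\<bar> = 1"
  shows "W \<sigma> m k \<omega> = tilt \<sigma> m k \<omega> * ((\<Sum>s\<in>{T_ep K m..<T_ep K (Suc m)}. Z k \<omega> s) - nt \<omega> m k * mean D k)
    - \<bar>tilt \<sigma> m k \<omega>\<bar> * (nt \<omega> m k * (epoch_corr \<omega> m / real (N_ep K (Suc m)))) - conf K (Suc m)"
proof -
  have N: "real (N_ep K (Suc m)) \<noteq> 0" using N_ep_pos[OF K, of m] by simp
  hence pn: "real (N_ep K (Suc m)) * pr \<omega> m k = nt \<omega> m k" by (simp add: pr_def)
  have "W \<sigma> m k \<omega> = tilt \<sigma> m k \<omega> * ((\<Sum>s\<in>{T_ep K m..<T_ep K (Suc m)}. Z k \<omega> s)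
        - (real (N_ep K (Suc m)) * pr \<omega> m k) * mean D k)
      - \<bar>tilt \<sigma> m k \<omega>\<bar> * (pr \<omega> m k * epoch_corr \<omega> m) - (tilt \<sigma> m k \<omega>)\<^sup>2 * (real (N_ep K (Suc m)) * pr \<omega> m k)"
    unfolding W_def step_def epoch_corr_def
    by (simp add: sum_subtractf sum_distrib_left[symmetric] sum_distrib_right[symmetric] T_ep_Suc
      right_diff_distrib mult.assoc mult.left_commute)
  thus ?thesis unfolding pn tilt_sq[OF assms] by (simp add: pr_def)
qed

text \<open>The width is \<open>2 a\<close> for the scale \<open>a = sqrt (conf / n)\<close>.
  Multiplying the deviation by \<open>a n\<close> yields \<open>2 conf\<close> plus the corruption
  penalty; \<open>W\<close> subtracts that penalty and one \<open>conf\<close>, leaving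
  \<open>conf\<close>.\<close>

lemma fail_imp_W:
  assumes "fail m \<omega>"
  shows "\<exists>k<K. \<exists>\<sigma>\<in>{1, -1}. conf K (Suc m) \<le> W \<sigma> m k \<omega>"
proof -
  obtain k where k: "k < K" and f: "sqrt (4 * conf K (Suc m) / nt \<omega> m k)
      + epoch_corr \<omega> m / real (N_ep K (Suc m)) < \<bar>r \<omega> (Suc m) k - mean D k\<bar>"
    using assms unfolding fail_def by blast
  define S where "S = (\<Sum>s\<in>{T_ep K m..<T_ep K (Suc m)}. Z k \<omega> s)"
  define n where "n = nt \<omega> m k"
  define a where "a = sqrt (conf K (Suc m) / n)"
  define c where "c = epoch_corr \<omega> m / real (N_ep K (Suc m))"
  have n: "0 < n" by (simp add: n_def nt_pos)
  have a: "0 < a" using n conf_ge_1[OF K, of "Suc m"] by (simp add: a_def)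
  have a2: "a * a * n = conf K (Suc m)"
    using n conf_ge_1[OF K, of "Suc m"] by (simp add: a_def)
  have c: "0 \<le> c" using epoch_corr_nonneg by (simp add: c_def)
  have "sqrt (4 * (conf K (Suc m) / n)) = sqrt 4 * a" unfolding a_def by (rule real_sqrt_mult)
  hence f': "2 * a + c < \<bar>r \<omega> (Suc m) k - mean D k\<bar>" using f by (simp add: n_def c_def)
  have r: "r \<omega> (Suc m) k = min (S / n) 1" unfolding r_Suc S_def n_def ..
  have m1: "mean D k \<le> 1" using mean_bounds[OF k] by simp
  define \<sigma> :: real where "\<sigma> = (if mean D k \<le> r \<omega> (Suc m) k then 1 else -1)"
  have \<sigma>: "\<sigma> \<in> {1, -1}" by (simp add: \<sigma>_def)
  \<comment> \<open>Truncating the estimate at 1 is harmless: it only reduces upward deviations, and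
    below the mean it is inactive because the mean is at most 1.\<close>
  have dev: "2 * a + c < \<sigma> * (S / n - mean D k)"
  proof (cases "mean D k \<le> r \<omega> (Suc m) k")
    case True
    thus ?thesis using f' r by (simp add: \<sigma>_def)
  next
    case False
    hence "r \<omega> (Suc m) k = S / n" using r m1 by (simp add: min_def split: if_splits)
    thus ?thesis using f' False by (simp add: \<sigma>_def)
  qed
  have s1: "\<bar>\<sigma>\<bar> = 1" using \<sigma> by auto
  have tilt: "tilt \<sigma> m k \<omega> = \<sigma> * a" "\<bar>tilt \<sigma> m k \<omega>\<bar> = a"
    using a s1 by (simp_all add: tilt_def a_def n_def abs_mult)
  have "(2 * a + c) * (a * n) \<le> \<sigma> * (S / n - mean D k) * (a * n)"
    using dev a n by (intro mult_right_mono) auto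
  also have "\<dots> = \<sigma> * a * (S - n * mean D k)" using n by (simp add: field_simps)
  finally have "2 * (a * a * n) + a * (n * c) \<le> \<sigma> * a * (S - n * mean D k)"
    by (simp add: algebra_simps)
  hence "conf K (Suc m) \<le> W \<sigma> m k \<omega>"
    unfolding W_eq[OF s1] tilt(2) unfolding tilt(1) S_def[symmetric] n_def[symmetric] c_def[symmetric] a2 by linarith
  thus ?thesis using k \<sigma> by blast
qed

text \<open>Markov's inequality and a union bound over \<open>2 K\<close> pairs of arm and sign.
  Each has probability at most \<open>exp (- conf) = beta_par / 4\<close>, giving
  \<open>delta_par / 2\<close> in total.\<close>

lemma prob_fail_le: "P.prob {\<omega> \<in> space P. fail m \<omega>} \<le> delta_par K (Suc m)"
proof -
  let ?F = "{\<omega> \<in> space P. fail m \<omega>}" and ?L = "conf K (Suc m)"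
  have [measurable]: "W \<sigma> m k \<in> borel_measurable P" for \<sigma> k
    unfolding W_def by measurable
  have pt: "indicator ?F \<omega> \<le> (\<Sum>k<K. \<Sum>\<sigma>\<in>{1, -1}. ennreal (exp (- ?L)) * ennreal (exp (W \<sigma> m k \<omega>)))" for \<omega>
  proof (cases "fail m \<omega>")
    case True
    then obtain k \<sigma> where k: "k < K" "\<sigma> \<in> {1, -1 :: real}" "?L \<le> W \<sigma> m k \<omega>"
      using fail_imp_W by blast
    have "indicator ?F \<omega> \<le> (1 :: ennreal)" by (simp add: indicator_def)
    also have "\<dots> \<le> ennreal (exp (- ?L)) * ennreal (exp (W \<sigma> m k \<omega>))"
      using k(3) by (simp add: ennreal_mult[symmetric] exp_add[symmetric])
    also have "\<dots> \<le> (\<Sum>\<sigma>\<in>{1, -1}. ennreal (exp (- ?L)) * ennreal (exp (W \<sigma> m k \<omega>)))"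
      using k(2) by (intro member_le_sum) auto
    also have "\<dots> \<le> (\<Sum>k<K. \<Sum>\<sigma>\<in>{1, -1}. ennreal (exp (- ?L)) * ennreal (exp (W \<sigma> m k \<omega>)))"
      using k(1) by (intro member_le_sum[of k "{..<K}"]) auto
    finally show ?thesis .
  qed simp
  have "emeasure P ?F = (\<integral>\<^sup>+\<omega>. indicator ?F \<omega> \<partial>P)" by simp
  also have "\<dots> \<le> (\<integral>\<^sup>+\<omega>. (\<Sum>k<K. \<Sum>\<sigma>\<in>{1, -1}. ennreal (exp (- ?L)) * ennreal (exp (W \<sigma> m k \<omega>))) \<partial>P)"
    by (intro nn_integral_mono pt)
  also have "\<dots> = (\<Sum>k<K. \<Sum>\<sigma>\<in>{1, -1}. ennreal (exp (- ?L)) * (\<integral>\<^sup>+\<omega>. ennreal (exp (W \<sigma> m k \<omega>)) \<partial>P))"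
    by (simp add: nn_integral_sum nn_integral_add nn_integral_cmult)
  also have "\<dots> \<le> (\<Sum>k<K. \<Sum>\<sigma>\<in>{1, -1 :: real}. ennreal (exp (- ?L)) * 1)"
  proof (intro sum_mono mult_left_mono)
    fix k and \<sigma> :: real assume "k \<in> {..<K}" "\<sigma> \<in> {1, -1}"
    hence "k < K" "\<bar>\<sigma>\<bar> = 1" by auto
    from exp_supermartingale[OF this order_refl, of m]
    show "(\<integral>\<^sup>+\<omega>. ennreal (exp (W \<sigma> m k \<omega>)) \<partial>P) \<le> 1" by (simp add: W_def T_ep_Suc)
  qed simp
  also have "\<dots> = ennreal (real K * (2 * exp (- ?L)))"
  proof -
    have c: "card {1, -1 :: real} = 2" by simp
    have "(\<Sum>k<K. \<Sum>\<sigma>\<in>{1, -1 :: real}. ennreal (exp (- ?L)) * 1)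
        = ennreal (real K) * (ennreal (real 2) * ennreal (exp (- ?L)))"
      by (simp only: sum_constant card_lessThan c ennreal_of_nat_eq_real_of_nat mult_1_right)
    thus ?thesis
      by (simp only: ennreal_mult[symmetric] of_nat_0_le_iff exp_ge_zero mult_nonneg_nonneg of_nat_numeral)
  qed
  also have "\<dots> \<le> ennreal (delta_par K (Suc m))"
  proof (rule ennreal_leI)
    have d: "0 < delta_par K (Suc m)"
      using zeta_pos[OF K, of "Suc m"] K by (simp add: delta_par_def)
    hence b: "0 < beta_par K (Suc m)" using K by (simp add: beta_par_def)
    have "exp (- ?L) = beta_par K (Suc m) / 4" using b by (simp add: conf_def exp_minus)
    thus "real K * (2 * exp (- ?L)) \<le> delta_par K (Suc m)"
      using K d by (simp add: beta_par_def)
  qed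
  finally show ?thesis
    using zeta_pos[OF K, of "Suc m"]
    by (simp add: P.emeasure_eq_measure ennreal_le_iff delta_par_def)
qed

subsection \<open>The regret bound\<close>

lemma corruption_eq: "corruption K adv \<omega> T = (\<Sum>t<T. cmax \<omega> t)"
  unfolding corruption_def cmax_def ..

lemma sum_epochs:
  fixes f :: "nat \<Rightarrow> real"
  shows "(\<Sum>t<T_ep K n. f t) = (\<Sum>m<n. \<Sum>t\<in>{T_ep K m..<T_ep K (Suc m)}. f t)"
proof (induction n)
  case (Suc n)
  have "(\<Sum>t\<in>{0..<T_ep K n}. f t) + (\<Sum>t\<in>{T_ep K n..<T_ep K (Suc n)}. f t) = (\<Sum>t\<in>{0..<T_ep K (Suc n)}. f t)"
    by (rule sum.atLeastLessThan_concat) (auto simp: T_ep_mono)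
  thus ?case using Suc by (simp add: lessThan_atLeast0)
qed simp

text \<open>Rewards lie in \<open>[0, 1]\<close> only almost surely, so integrability of the
  corruption rests on an almost-everywhere bound.\<close>

lemma AE_cmax_le: "AE \<omega> in P. cmax \<omega> t \<le> 1"
proof -
  have "AE x in D. \<forall>k<K. 0 \<le> x k \<and> x k \<le> 1"
    using D by (simp add: valid_reward_dist_def)
  hence "AE x in distr (D \<Otimes>\<^sub>M unif) D fst. \<forall>k<K. 0 \<le> x k \<and> x k \<le> 1"
    by (subst prob_space.distr_pair_fst[OF prob_space_unif])
  hence "AE x in D \<Otimes>\<^sub>M unif. \<forall>k<K. 0 \<le> fst x k \<and> fst x k \<le> 1"
    by (rule AE_distrD[OF measurable_fst])
  hence "AE \<omega> in P. \<forall>k<K. 0 \<le> fst (\<omega> t) k \<and> fst (\<omega> t) k \<le> 1"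
    unfolding omega_space_def by (intro AE_PiM_component prob_space_round) auto
  thus ?thesis
  proof eventually_elim
    case (elim \<omega>)
    have "\<bar>corrupted K adv \<omega> t k - fst (\<omega> t) k\<bar> \<le> 1" if "k < K" for k
    proof -
      have "0 \<le> fst (\<omega> t) k" "fst (\<omega> t) k \<le> 1" using elim that by auto
      thus ?thesis using corrupted_bounds[OF that, of \<omega> t] by linarith
    qed
    thus ?case unfolding cmax_def using core.arms_nonempty by (subst Max_le_iff) auto
  qed
qed

lemma integrable_corruption: "integrable P (\<lambda>\<omega>. corruption K adv \<omega> T)"
  unfolding corruption_eq
proof (intro Bochner_Integration.integrable_sum P.integrable_const_bound[of _ 1])
  fix t
  show "AE \<omega> in P. norm (cmax \<omega> t) \<le> 1"
    using AE_cmax_le[of t] by eventually_elim (use cmax_nonneg in simp)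
qed simp

lemma integrable_gap: "integrable P (\<lambda>\<omega>. gap K D (arm K adv \<omega> t))"
proof (rule P.integrable_const_bound[of _ 1])
  show "(\<lambda>\<omega>. gap K D (arm K adv \<omega> t)) \<in> borel_measurable P"
    by (rule measurable_compose[OF measurable_arm]) simp
qed (use gap_bounds arm_less in auto)

lemma integrable_mean_gap: "integrable P (\<lambda>\<omega>. \<Sum>k<K. pr \<omega> m k * gap K D k)"
proof (rule P.integrable_const_bound[of _ 1])
  show "(\<lambda>\<omega>. \<Sum>k<K. pr \<omega> m k * gap K D k) \<in> borel_measurable P"
    unfolding pr_def by measurable
  show "AE \<omega> in P. norm (\<Sum>k<K. pr \<omega> m k * gap K D k) \<le> 1"
  proof (rule AE_I2)
    fix \<omega>
    have "(\<Sum>k<K. pr \<omega> m k * gap K D k) \<le> (\<Sum>k<K. pr \<omega> m k)"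
      using gap_bounds pr_nonneg by (intro sum_mono mult_left_le) auto
    moreover have "0 \<le> (\<Sum>k<K. pr \<omega> m k * gap K D k)"
      using gap_bounds pr_nonneg by (intro sum_nonneg mult_nonneg_nonneg) auto
    ultimately show "norm (\<Sum>k<K. pr \<omega> m k * gap K D k) \<le> 1" by (simp add: sum_pr)
  qed
qed

text \<open>Gaps are nonnegative and the process is defined for all rounds, so the horizon may be
  extended to the end of the running epoch.\<close>

lemma pseudo_regret_le:
  assumes "T \<le> T_ep K n"
  shows "pseudo_regret K D adv T \<le> (\<integral>\<omega>. (\<Sum>m<n. \<Sum>k<K. nt \<omega> m k * gap K D k) \<partial>P)"
proof -
  have nt: "(\<Sum>k<K. nt \<omega> m k * gap K D k) = real (N_ep K (Suc m)) * (\<Sum>k<K. pr \<omega> m k * gap K D k)" for \<omega> m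
    using N_ep_pos[OF K, of m] by (simp add: pr_def sum_distrib_left)
  have "pseudo_regret K D adv T = (\<Sum>t<T. \<integral>\<omega>. gap K D (arm K adv \<omega> t) \<partial>P)"
    unfolding pseudo_regret_def by (intro Bochner_Integration.integral_sum integrable_gap)
  also have "\<dots> \<le> (\<Sum>t<T_ep K n. \<integral>\<omega>. gap K D (arm K adv \<omega> t) \<partial>P)"
    using assms gap_bounds arm_less by (intro sum_mono2 integral_nonneg_AE AE_I2) auto
  also have "\<dots> = (\<Sum>m<n. \<Sum>t\<in>{T_ep K m..<T_ep K (Suc m)}. \<integral>\<omega>. gap K D (arm K adv \<omega> t) \<partial>P)"
    by (rule sum_epochs)
  also have "\<dots> = (\<Sum>m<n. \<Sum>t\<in>{T_ep K m..<T_ep K (Suc m)}. \<integral>\<omega>. (\<Sum>k<K. pr \<omega> m k * gap K D k) \<partial>P)"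
    by (intro sum.cong refl expected_gap) auto
  also have "\<dots> = (\<Sum>m<n. \<integral>\<omega>. (\<Sum>k<K. nt \<omega> m k * gap K D k) \<partial>P)"
    unfolding nt by (simp add: T_ep_Suc)
  also have "\<dots> = (\<integral>\<omega>. (\<Sum>m<n. \<Sum>k<K. nt \<omega> m k * gap K D k) \<partial>P)"
    unfolding nt
    by (intro Bochner_Integration.integral_sum[symmetric] integrable_mult_right integrable_mean_gap)
  finally show ?thesis .
qed

text \<open>Only epochs completed by round \<open>T\<close> appear, so no corruption beyond the
  horizon is counted even though the regret was extended to a full epoch.\<close>

lemma weighted_err_le:
  assumes "T_ep K M \<le> T"
  shows "(\<Sum>m\<in>{1..M}. real (N_ep K m) * err \<omega> m)
    \<le> (\<Sum>j<M. real (N_ep K (Suc j)) * of_bool (fail j \<omega>)) + corruption K adv \<omega> T"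
proof -
  have "(\<Sum>m\<in>{1..M}. real (N_ep K m) * err \<omega> m) = (\<Sum>j<M. real (N_ep K (Suc j)) * err \<omega> (Suc j))"
    by (rule sum.reindex_bij_witness[of _ Suc "\<lambda>m. m - 1"]) auto
  also have "\<dots> \<le> (\<Sum>j<M. real (N_ep K (Suc j)) * of_bool (fail j \<omega>) + epoch_corr \<omega> j)"
    using N_ep_pos[OF K] epoch_corr_nonneg by (intro sum_mono) (auto simp: err_def)
  also have "\<dots> = (\<Sum>j<M. real (N_ep K (Suc j)) * of_bool (fail j \<omega>)) + (\<Sum>t<T_ep K M. cmax \<omega> t)"
    by (simp add: sum.distrib sum_epochs epoch_corr_def)
  also have "(\<Sum>t<T_ep K M. cmax \<omega> t) \<le> corruption K adv \<omega> T"
    unfolding corruption_eq using assms cmax_nonneg by (intro sum_mono2) auto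
  finally show ?thesis by simp
qed

lemma regret_bound:
  assumes T: "2 \<le> T" and ex: "\<exists>k<K. 0 < gap K D k"
  defines "X \<equiv> (\<Sum>k\<in>{k. k < K \<and> 0 < gap K D k}. ln (real T) * ln (real K * real T) / gap K D k)"
    and "Y \<equiv> real K * ln (1 / min_gap K D) * ln (real K / min_gap K D) / min_gap K D"
  shows "pseudo_regret K D adv T
    \<le> 1700000 * ((\<integral>\<omega>. corruption K adv \<omega> T \<partial>P) + X + Y)"
proof -
  have g: "run.g = gap K D"
    by (simp add: fun_eq_iff run.g_def run.best_def gap_def)
  let ?G = "{gap K D k | k. k < K \<and> 0 < gap K D k}"
  define d where "d = min_gap K D"
  have fin: "finite ?G" by (rule finite_subset[of _ "gap K D ` {..<K}"]) auto
  have "d \<in> ?G" unfolding d_def min_gap_def using fin ex by (intro Min_in) auto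
  hence d: "0 < d" "d \<le> 1" using gap_bounds by auto
  have d_le: "d \<le> gap K D k" if "k < K" "0 < gap K D k" for k
    unfolding d_def min_gap_def using fin that by (intro Min_le) auto
  define H where "H = ln (real T) * ln (real K * real T)"
  have lT: "1 / 2 \<le> ln (real T)" using ln_arms_ge T by blast
  have lKT: "1 \<le> ln (real K * real T)"
    using ln_arms_ge[OF K] lT K T by (simp add: ln_mult)
  have X: "X = H * run.inv_gaps"
    unfolding X_def H_def run.inv_gaps_def g by (simp add: sum_distrib_left)
  have inv1: "1 \<le> run.inv_gaps" using ex run.inv_gaps_ge_1 unfolding g by blast
  \<comment> \<open>Since \<open>ln T \<le> X\<close>, the O(1) failure cost of each of the
    \<open>O(ln T)\<close> epochs can be charged to \<open>X\<close>.\<close>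
  have "ln (real T) * 1 * 1 \<le> ln (real T) * ln (real K * real T) * run.inv_gaps"
    using lT lKT inv1 by (intro mult_mono) auto
  hence lnX: "ln (real T) \<le> X" unfolding X H_def by simp
  have X0: "0 \<le> X" using lnX lT by linarith
  have Y0: "0 \<le> Y"
  proof -
    have "0 \<le> ln (1 / d)" "0 \<le> ln (real K / d)" using d K by (simp_all add: pos_le_divide_eq)
    thus ?thesis using d unfolding Y_def d_def[symmetric] by simp
  qed
  \<comment> \<open>Rounds are counted from 0, so the last round is \<open>T - 1\<close>; it lies in
    epoch \<open>Suc M\<close>.\<close>
  obtain M where M: "T_ep K M \<le> T - 1" "T - 1 < T_ep K (Suc M)" by (rule ex_epoch[OF K])
  have MT: "T_ep K M < T" "T \<le> T_ep K (Suc M)" using M T by auto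
  have Mln: "real M \<le> 3 * ln (real T)" using epoch_count_le[OF K T MT(1)] by simp
  define F where "F \<omega> = (\<Sum>j<M. real (N_ep K (Suc j)) * of_bool (fail j \<omega>))" for \<omega>
  define C where "C \<omega> = corruption K adv \<omega> T" for \<omega>
  define A where "A = 1622016 * X + 393216 * Y"
  have pt: "(\<Sum>m<Suc M. \<Sum>k<K. nt \<omega> m k * gap K D k) \<le> A + 672 * (F \<omega> + C \<omega>)" for \<omega>
  proof -
    have "(\<Sum>m<Suc M. \<Sum>k<K. nt \<omega> m k * gap K D k)
        \<le> A + 672 * (\<Sum>m\<in>{1..M}. real (N_ep K m) * err \<omega> m)"
      using run.run_regret[OF T MT(1) d, of \<omega>] d_le
      unfolding g nt_def A_def X H_def Y_def d_def by blast
    also have "\<dots> \<le> A + 672 * (F \<omega> + C \<omega>)"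
      unfolding F_def C_def using MT(1) by (intro add_left_mono mult_left_mono weighted_err_le) auto
    finally show ?thesis .
  qed
  have int_fail: "integrable P (\<lambda>\<omega>. of_bool (fail j \<omega>) :: real)" for j
    by (rule P.integrable_const_bound[of _ 1]) auto
  have E_fail: "(\<integral>\<omega>. of_bool (fail j \<omega>) \<partial>P) = P.prob {\<omega> \<in> space P. fail j \<omega>}" for j
  proof -
    have "(\<integral>\<omega>. (of_bool (fail j \<omega>) :: real) \<partial>P) = (\<integral>\<omega>. indicator {\<omega> \<in> space P. fail j \<omega>} \<omega> \<partial>P)"
      by (intro Bochner_Integration.integral_cong) (auto simp: indicator_def)
    thus ?thesis by simp
  qed
  have int_F: "integrable P F"
    unfolding F_def by (intro Bochner_Integration.integrable_sum integrable_mult_right int_fail)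
  have int_C: "integrable P C"
    unfolding C_def by (rule integrable_corruption)
  have "(\<integral>\<omega>. F \<omega> \<partial>P)
      = (\<Sum>j<M. \<integral>\<omega>. real (N_ep K (Suc j)) * of_bool (fail j \<omega>) \<partial>P)"
    unfolding F_def by (intro Bochner_Integration.integral_sum integrable_mult_right int_fail)
  also have "\<dots> = (\<Sum>j<M. real (N_ep K (Suc j)) * P.prob {\<omega> \<in> space P. fail j \<omega>})"
    by (simp only: integral_mult_right_zero E_fail)
  also have "\<dots> \<le> (\<Sum>j<M. 18)"
  proof (rule sum_mono)
    fix j
    have "real (N_ep K (Suc j)) * P.prob {\<omega> \<in> space P. fail j \<omega>}
        \<le> real (N_ep K (Suc j)) * delta_par K (Suc j)"
      by (intro mult_left_mono prob_fail_le) simp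
    also have "\<dots> \<le> 18" using delta_N_ep_le[OF K, of j] by (simp add: mult.commute)
    finally show "real (N_ep K (Suc j)) * P.prob {\<omega> \<in> space P. fail j \<omega>} \<le> 18" .
  qed
  finally have EF: "(\<integral>\<omega>. F \<omega> \<partial>P) \<le> 18 * real M" by simp
  have EC: "0 \<le> (\<integral>\<omega>. C \<omega> \<partial>P)"
    unfolding C_def by (intro integral_nonneg_AE AE_I2) (simp add: corruption_eq sum_nonneg cmax_nonneg)
  have int_FC: "integrable P (\<lambda>\<omega>. 672 * (F \<omega> + C \<omega>))"
    by (intro integrable_mult_right Bochner_Integration.integrable_add int_F int_C)
  have nt: "(\<Sum>k<K. nt \<omega> m k * gap K D k) = real (N_ep K (Suc m)) * (\<Sum>k<K. pr \<omega> m k * gap K D k)" for \<omega> m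
    using N_ep_pos[OF K, of m] by (simp add: pr_def sum_distrib_left)
  have int_R: "integrable P (\<lambda>\<omega>. \<Sum>m<Suc M. \<Sum>k<K. nt \<omega> m k * gap K D k)"
    unfolding nt by (intro Bochner_Integration.integrable_sum integrable_mult_right integrable_mean_gap)
  have "pseudo_regret K D adv T \<le> (\<integral>\<omega>. (\<Sum>m<Suc M. \<Sum>k<K. nt \<omega> m k * gap K D k) \<partial>P)"
    by (rule pseudo_regret_le[OF MT(2)])
  also have "\<dots> \<le> (\<integral>\<omega>. A + 672 * (F \<omega> + C \<omega>) \<partial>P)"
    by (rule integral_mono[OF int_R _ pt]) (intro Bochner_Integration.integrable_add P.integrable_const int_FC)
  also have "\<dots> = A + 672 * ((\<integral>\<omega>. F \<omega> \<partial>P) + (\<integral>\<omega>. C \<omega> \<partial>P))"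
    using int_F int_C int_FC by (simp add: P.prob_space)
  finally have R: "pseudo_regret K D adv T \<le> A + 672 * ((\<integral>\<omega>. F \<omega> \<partial>P) + (\<integral>\<omega>. C \<omega> \<partial>P))" .
  \<comment> \<open>Here \<open>18 M \<le> 18 * 3 ln T\<close>. The coefficient of \<open>X\<close>
    becomes \<open>1622016 + 672 * 54 = 1658304\<close>, below the claimed 1700000.\<close>
  have "(\<integral>\<omega>. F \<omega> \<partial>P) \<le> 54 * X" using EF Mln lnX by linarith
  with R EC X0 Y0 show ?thesis unfolding A_def C_def by argo
qed

end

theorem theorem1:
  shows "\<exists>c::real>0. \<forall>K T D adv.
     2 \<le> K \<longrightarrow> 2 \<le> T \<longrightarrow> valid_reward_dist K D \<longrightarrow> valid_adversary K adv \<longrightarrow>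
     (\<exists>k<K. 0 < gap K D k) \<longrightarrow>
     pseudo_regret K D adv T
       \<le> c * ((\<integral>\<omega>. corruption K adv \<omega> T \<partial>omega_space D)
              + (\<Sum>k\<in>{k. k < K \<and> 0 < gap K D k}. ln (real T) * ln (real K * real T) / gap K D k)
              + real K * ln (1 / min_gap K D) * ln (real K / min_gap K D) / min_gap K D)"
proof (intro exI[of _ 1700000] conjI allI impI)
  fix K T :: nat and D :: "(nat \<Rightarrow> real) measure" and adv :: adversary
  assume "2 \<le> K" and T: "2 \<le> T" and "valid_reward_dist K D" "valid_adversary K adv"
    and ex: "\<exists>k<K. 0 < gap K D k"
  then interpret corrupted_bandit K D adv by unfold_locales
  show "pseudo_regret K D adv T
       \<le> 1700000 * ((\<integral>\<omega>. corruption K adv \<omega> T \<partial>omega_space D)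
              + (\<Sum>k\<in>{k. k < K \<and> 0 < gap K D k}. ln (real T) * ln (real K * real T) / gap K D k)
              + real K * ln (1 / min_gap K D) * ln (real K / min_gap K D) / min_gap K D)"
    by (rule regret_bound[OF T ex])
qed simp

end
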